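(* Let $\Gamma$ be a signed graph. Then $\omega X_{\Gamma} = \overline{X}_{\Gamma}$, where $X_\Gamma$ is the chromatic signed-symmetric function of $\Gamma$, $\overline{X}_\Gamma$ is its closed-chamber analogue, and $\omega$ is the involution on the ring $\mathrm{SSym}_{\mathbb{Q}}$ of signed-symmetric functions over $\mathbb{Q}$ (all defined in the context).
   Context: A signed graph is a quadruple $\Gamma=(V_\Gamma,E_\Gamma^+,E_\Gamma^-,L_\Gamma)$ where $V_\Gamma$ is a finite set (vertices), $E_\Gamma^+$ and $E_\Gamma^-$ are sets of 2-element subsets of $V_\Gamma$ (positive and negative edges; they may intersect), and $L_\Gamma\subseteq V_\Gamma$ (loops). Label the vertices so that $V_\Gamma=[\ell]=\{1,\dots,\ell\}$ (the functions below do not depend on the labelling). The signed-graphic arrangement in $\mathbb{R}^\ell$ with coordinates $z_1,\dots,z_\ell$ is $$\mathcal{A}_\Gamma=\{\{z_i=z_j\}: \{i,j\}\in E_\Gamma^+\}\cup\{\{z_i=-z_j\}:\{i,j\}\in E_\Gamma^-\}\cup\{\{z_i=0\}: i\in L_\Gamma\}.$$ A chamber of $\mathcal{A}_\Gamma$ is a connected component of $\mathbb{R}^\ell\setminus\bigcup_{H\in\mathcal{A}_\Gamma}H$; $\overline{C}$ denotes the closure of a chamber $C$. With indeterminates $\boldsymbol{x}=(x_i)_{i\in\mathbb{Z}}$, define the formal power series $$X_\Gamma=\sum_C\sum_{\boldsymbol\alpha\in C\cap\mathbb{Z}^\ell}x_{\alpha_1}\cdots x_{\alpha_\ell},\qquad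 \overline{X}_\Gamma=\sum_C\sum_{\boldsymbol\alpha\in \overline{C}\cap\mathbb{Z}^\ell}x_{\alpha_1}\cdots x_{\alpha_\ell},$$ where $C$ ranges over all chambers of $\mathcal{A}_\Gamma$ and $\boldsymbol\alpha=(\alpha_1,\dots,\alpha_\ell)$. A signed permutation is a permutation $\sigma$ of $\mathbb{Z}$ with $\sigma(-i)=-\sigma(i)$ for all $i$; it acts by $\sigma(x_i)=x_{\sigma(i)}$. $\mathrm{SSym}_{\mathbb{Z}}$ is the ring of formal power series in $\mathbb{Z}[[\boldsymbol{x}]]$ whose monomials have bounded degree and which are invariant under all signed permutations; $\mathrm{SSym}_{\mathbb{Q}}=\mathrm{SSym}_{\mathbb{Z}}\otimes_{\mathbb{Z}}\mathbb{Q}$. For nonnegative integers $a,b$ with $(a,b)\ne(0,0)$ put $p_{\binom{a}{b}}=\sum_{i\in\mathbb{Z}}x_i^a x_{-i}^b$ (so $p_{\binom{a}{b}}=p_{\binom{b}{a}}$). The ring $\mathrm{SSym}_{\mathbb{Q}}$ is a free commutative $\mathbb{Q}$-algebra on $x_0$ and the $p_{\binom{a}{b}}$ with $a\ge b\geq 0$, $(a,b)\neq(0,0)$, and $\omega:\mathrm{SSym}_{\mathbb{Q}}\to\mathrm{SSym}_{\mathbb{Q}}$ is the $\mathbb{Q}$-algebra homomorphism with $\omega x_0=-x_0$ and $\omega p_{\binom{a}{b}}=(-1)^{a+b-1}p_{\binom{a}{b}}$. It is known that $X_\Gamma\in\mathrm{SSym}_{\mathbb{Z}}$. *)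

theory Defs
  imports "HOL-Analysis.Analysis" "HOL-Algebra.Module" "HOL-Library.Multiset"
begin

record 'v signed_graph =
  verts :: "'v set"
  pos_edges :: "'v set set"
  neg_edges :: "'v set set"
  loops :: "'v set"

definition is_signed_graph :: "'v signed_graph \<Rightarrow> bool" where
  "is_signed_graph \<Gamma> \<longleftrightarrow>
     finite (verts \<Gamma>) \<and>
     (\<forall>e\<in>pos_edges \<Gamma>. e \<subseteq> verts \<Gamma> \<and> card e = 2) \<and>
     (\<forall>e\<in>neg_edges \<Gamma>. e \<subseteq> verts \<Gamma> \<and> card e = 2) \<and>
     loops \<Gamma> \<subseteq> verts \<Gamma>"

text \<open>
  The ambient space is the product space \<open>\<real>\<^sup>V\<close> of functions that are extensional on the
  finite vertex set \<open>V\<close>, i.e. \<open>powertop_real V\<close>.  Its coordinates are indexed by the vertices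
  themselves, so no labelling by \<open>1, \<dots>, card V\<close> has to be chosen, and \<open>V = {}\<close> is allowed.
\<close>

definition arrangement :: "'v signed_graph \<Rightarrow> ('v \<Rightarrow> real) set set" where
  "arrangement \<Gamma> =
     {{z \<in> topspace (powertop_real (verts \<Gamma>)). z i = z j} | i j. {i, j} \<in> pos_edges \<Gamma>} \<union>
     {{z \<in> topspace (powertop_real (verts \<Gamma>)). z i = - z j} | i j. {i, j} \<in> neg_edges \<Gamma>} \<union>
     {{z \<in> topspace (powertop_real (verts \<Gamma>)). z i = 0} | i. i \<in> loops \<Gamma>}"

definition chambers :: "'v signed_graph \<Rightarrow> ('v \<Rightarrow> real) set set" where
  "chambers \<Gamma> = connected_components_of
     (subtopology (powertop_real (verts \<Gamma>))
        (topspace (powertop_real (verts \<Gamma>)) - \<Union>(arrangement \<Gamma>)))"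

text \<open>
  A monomial in the indeterminates \<open>x\<^sub>i\<close>, \<open>i \<in> \<int>\<close>, is the finite multiset of the indices of
  its factors; a formal power series is its coefficient function.
\<close>

type_synonym 'a series = "int multiset \<Rightarrow> 'a"

text \<open>
  The formal sum of the monomials \<open>mono_of t\<close>, \<open>t \<in> T\<close>.  It makes sense only if every monomial occurs
  finitely often (\<open>card\<close> is \<open>0\<close> on infinite sets), which is the case in all uses below
  (the degenerate \<open>power_sum 0 0\<close> is never used).
\<close>

definition monomial_sum :: "'t set \<Rightarrow> ('t \<Rightarrow> int multiset) \<Rightarrow> int series" where
  "monomial_sum T mono_of = (\<lambda>m. int (card {t \<in> T. mono_of t = m}))"

definition lattice_points :: "'v set \<Rightarrow> ('v \<Rightarrow> real) set \<Rightarrow> ('v \<Rightarrow> int) set" where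
  "lattice_points V S = {\<alpha> \<in> V \<rightarrow>\<^sub>E UNIV. restrict (\<lambda>i. real_of_int (\<alpha> i)) V \<in> S}"

definition point_monomial :: "'v set \<Rightarrow> ('v \<Rightarrow> int) \<Rightarrow> int multiset" where
  "point_monomial V \<alpha> = image_mset \<alpha> (mset_set V)"

definition chromatic :: "'v signed_graph \<Rightarrow> int series" where
  "chromatic \<Gamma> = (\<lambda>m. \<Sum>C\<in>chambers \<Gamma>.
     monomial_sum (lattice_points (verts \<Gamma>) C) (point_monomial (verts \<Gamma>)) m)"

definition chromatic_closed :: "'v signed_graph \<Rightarrow> int series" where
  "chromatic_closed \<Gamma> = (\<lambda>m. \<Sum>C\<in>chambers \<Gamma>.
     monomial_sum (lattice_points (verts \<Gamma>) (powertop_real (verts \<Gamma>) closure_of C))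
       (point_monomial (verts \<Gamma>)) m)"

definition signed_permutation :: "(int \<Rightarrow> int) \<Rightarrow> bool" where
  "signed_permutation \<sigma> \<longleftrightarrow> bij \<sigma> \<and> (\<forall>i. \<sigma> (- i) = - \<sigma> i)"

text \<open>
  The action \<open>\<sigma>(x\<^sub>i) = x_{\<sigma>(i)}\<close>: the coefficient of \<open>m\<close> in \<open>\<sigma>(f)\<close> is that of
  the \<open>\<sigma>\<close>-preimage of \<open>m\<close> in \<open>f\<close>.
\<close>

definition act :: "(int \<Rightarrow> int) \<Rightarrow> 'a series \<Rightarrow> 'a series" where
  "act \<sigma> f = (\<lambda>m. f (image_mset (inv_into UNIV \<sigma>) m))"

definition SSym_int :: "int series set" where
  "SSym_int = {f. (\<exists>d. \<forall>m. f m \<noteq> 0 \<longrightarrow> size m \<le> d) \<and>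
                  (\<forall>\<sigma>. signed_permutation \<sigma> \<longrightarrow> act \<sigma> f = f)}"

definition rat_series :: "int series \<Rightarrow> rat series" where
  "rat_series f = (\<lambda>m. rat_of_int (f m))"

definition scale_series :: "rat \<Rightarrow> rat series \<Rightarrow> rat series" where
  "scale_series q f = (\<lambda>m. q * f m)"

text \<open>
  \<open>SSym_int \<otimes> \<rat>\<close> as a \<open>\<rat>\<close>-algebra of rational power series: every element of the tensor product
  is a pure tensor \<open>g \<otimes> q\<close> (common denominators), and \<open>g \<otimes> q \<mapsto> q g\<close> is injective since
  \<open>SSym_int\<close> is torsion-free.
\<close>

definition SSym_rat :: "(rat, rat series) module" where
  "SSym_rat =
     \<lparr>carrier = {scale_series q (rat_series g) | q g. g \<in> SSym_int},
      mult = (\<lambda>f g m. \<Sum>(a, b)\<in>{(a, b). a + b = m}. f a * g b),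
      one = (\<lambda>m. if m = {#} then 1 else 0),
      zero = (\<lambda>m. 0),
      add = (\<lambda>f g m. f m + g m),
      smult = scale_series\<rparr>"

definition x_zero :: "int series" where
  "x_zero = (\<lambda>m. if m = {#0#} then 1 else 0)"

definition power_sum :: "nat \<Rightarrow> nat \<Rightarrow> int series" where
  "power_sum a b = monomial_sum UNIV (\<lambda>i. replicate_mset a i + replicate_mset b (- i))"

text \<open>
  Functions are taken extensional on the carrier, so that \<open>THE\<close> picks the unique homomorphism;
  existence and uniqueness hold because \<open>SSym_rat\<close> is free on the listed generators.
\<close>

definition omega :: "rat series \<Rightarrow> rat series" where
  "omega = (THE w.
     w \<in> carrier SSym_rat \<rightarrow>\<^sub>E carrier SSym_rat \<and>
     w \<in> ring_hom SSym_rat SSym_rat \<and>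
     (\<forall>q. \<forall>f\<in>carrier SSym_rat. w (q \<odot>\<^bsub>SSym_rat\<^esub> f) = q \<odot>\<^bsub>SSym_rat\<^esub> w f) \<and>
     w (rat_series x_zero) = (- 1) \<odot>\<^bsub>SSym_rat\<^esub> rat_series x_zero \<and>
     (\<forall>a b. b \<le> a \<and> (a, b) \<noteq> (0, 0) \<longrightarrow>
        w (rat_series (power_sum a b)) =
          ((- 1) ^ (a + b - 1)) \<odot>\<^bsub>SSym_rat\<^esub> rat_series (power_sum a b)))"

end

theory Submission
  imports Defs "HOL-Computational_Algebra.Polynomial"
begin

text \<open>
  Both series are instances of a deletion-contraction recursion for lists of type B linear forms on
  weighted vertices: adding a form \<open>f\<close> removes from the open points those with \<open>f = 0\<close>, which are
  the open points of the contraction, and adds to the number of closed chambers through a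
  point of \<open>f = 0\<close> the number of closed chambers of the contraction.  Contraction merges two
  vertices, or a vertex into the power of \<open>x\<^sub>0\<close>, so without forms the series is a product
  of generators, and the sign \<open>(- 1) ^ codimension\<close> in \<open>\<omega>\<close> accounts for the different signs of
  the two recursions.

  That \<open>\<omega>\<close> exists is seen without algebraic independence of the generators: for odd \<open>N\<close>,
  substituting \<open>x\<^sub>j\<close> for the \<open>N\<close> variables with index nearest to \<open>N j\<close> multiplies every
  \<open>p\<close> by \<open>N\<close> and fixes \<open>x\<^sub>0\<close>; the coefficients of the result are polynomials in \<open>N\<close>, and up to
  the sign \<open>(- 1) ^ degree\<close> their values at \<open>N = - 1\<close> give \<open>\<omega>\<close>.  It is unique because the sum
  over an orbit of monomials is, up to a factor, the open series of the list of all type B forms,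
  hence a polynomial in the generators.
\<close>

section \<open>Series, push-forwards and the ring of signed-symmetric functions\<close>

text \<open>\<open>omega\<close> is a \<open>THE\<close>, so nothing can be said of it before a map
  with its properties is known to exist and to be unique. The relation \<open>omega_rel\<close>
  separates the tasks: it respects the ring operations by construction, so that being single-valued,
  being total and relating the two series of a graph become independent claims. Only for odd
  \<open>N\<close> do \<open>N\<close> integers form a block symmetric about its centre, so that
  rounding commutes with negation, as the mixed factors of a power sum demand. The value - 1 is
  forced: a power sum of degree d is multiplied by \<open>N\<close> and must receive (-1)^(d - 1) =
  (-1)^d * (-1), while \<open>x_zero\<close> is fixed and (-1)^1 is already its sign. A product of k
  power sums and a power of \<open>x_zero\<close>, of total degree d, receives (-1)^(d - k).
  Contraction keeps d and lowers k by one, which turns the difference in the open recursion into the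
  sum in the closed one. Forms come in lists because contraction can make them coincide, become
  proportional or vanish. A vanishing form makes both series 0, which keeps the recursion
  uniform.\<close>

definition series_mult :: "rat series \<Rightarrow> rat series \<Rightarrow> rat series" where
  "series_mult f g = (\<lambda>m. \<Sum>(a, b)\<in>{(a, b). a + b = m}. f a * g b)"

definition series_one :: "rat series" where
  "series_one = (\<lambda>m. if m = {#} then 1 else 0)"

lemma SSym_rat_simps [simp]:
  "mult SSym_rat = series_mult"
  "one SSym_rat = series_one"
  "add SSym_rat = (\<lambda>f g m. f m + g m)"
  "smult SSym_rat = scale_series"
  by (simp_all add: SSym_rat_def series_mult_def[abs_def] series_one_def)

section \<open>Finite fibres and products of monomial sums\<close>

lemma finite_msets_bounded:
  assumes "finite A"
  shows "finite {m. set_mset m \<subseteq> A \<and> size m \<le> n}"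
proof -
  have "{m. set_mset m \<subseteq> A \<and> size m \<le> n} \<subseteq> mset ` {xs. set xs \<subseteq> A \<and> length xs \<le> n}"
  proof
    fix m assume m: "m \<in> {m. set_mset m \<subseteq> A \<and> size m \<le> n}"
    obtain xs where "m = mset xs" by (metis ex_mset)
    then show "m \<in> mset ` {xs. set xs \<subseteq> A \<and> length xs \<le> n}" using m by auto
  qed
  then show ?thesis
    using finite_lists_length_le[OF assms] finite_surj by blast
qed

lemma finite_mset_splittings: "finite {(a, b). a + b = (m :: 'a multiset)}"
proof -
  have "{(a, b). a + b = m} \<subseteq> (\<lambda>a. (a, m - a)) ` {a. set_mset a \<subseteq> set_mset m \<and> size a \<le> size m}"
    by auto
  then show ?thesis using finite_msets_bounded[of "set_mset m" "size m"] finite_surj by blast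
qed

lemma finite_image_mset_vimage:
  assumes "\<And>j. finite {i. \<phi> i = j}"
  shows "finite {m'. image_mset \<phi> m' = m}"
proof -
  have "{m'. image_mset \<phi> m' = m} \<subseteq>
      {m'. set_mset m' \<subseteq> (\<Union>j\<in>set_mset m. {i. \<phi> i = j}) \<and> size m' \<le> size m}" by auto
  moreover have "finite \<dots>" using assms by (intro finite_msets_bounded) auto
  ultimately show ?thesis using finite_subset by blast
qed

lemma monomial_sum_reindex:
  assumes "bij_betw g T S" "\<And>t. t \<in> T \<Longrightarrow> f' t = f (g t)"
  shows "monomial_sum S f = monomial_sum T f'"
proof
  fix m
  have "bij_betw g {t \<in> T. f' t = m} {s \<in> S. f s = m}"
    using assms by (auto simp: bij_betw_def inj_on_def)
  then show "monomial_sum S f m = monomial_sum T f' m"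
    by (simp add: monomial_sum_def bij_betw_same_card)
qed

text \<open>The fibre over \<open>m\<close> is the disjoint union, over the splittings
  \<open>a + b = m\<close>, of products of fibres. Finiteness keeps \<open>card\<close> from reading
  an infinite fibre as 0.\<close>

lemma series_mult_monomial_sum:
  assumes T: "\<And>m. finite {t \<in> T. f t = m}" and S: "\<And>m. finite {s \<in> S. g s = m}"
  shows "series_mult (rat_series (monomial_sum T f)) (rat_series (monomial_sum S g)) =
    rat_series (monomial_sum (T \<times> S) (\<lambda>(t, s). f t + g s))"
proof
  fix m :: "int multiset"
  let ?P = "{(a, b). a + b = m}"
  have eq: "{p \<in> T \<times> S. (\<lambda>(t, s). f t + g s) p = m} =
      (\<Union>(a, b)\<in>?P. {t \<in> T. f t = a} \<times> {s \<in> S. g s = b})" by auto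
  have "card {p \<in> T \<times> S. (\<lambda>(t, s). f t + g s) p = m} =
      (\<Sum>(a, b)\<in>?P. card ({t \<in> T. f t = a} \<times> {s \<in> S. g s = b}))"
    unfolding eq by (subst card_UN_disjoint)
      (auto simp: finite_mset_splittings T S intro!: finite_cartesian_product sum.cong)
  then show "series_mult (rat_series (monomial_sum T f)) (rat_series (monomial_sum S g)) m =
    rat_series (monomial_sum (T \<times> S) (\<lambda>(t, s). f t + g s)) m"
    by (simp add: series_mult_def rat_series_def monomial_sum_def card_cartesian_product case_prod_beta)
qed

text \<open>The substitution of x_(\<open>\<phi> i\<close>) for x_i. In contrast to
  \<open>act\<close>, it may merge variables, so coefficients are added up; finite fibres of
  \<open>\<phi>\<close> make the sum finite.\<close>

definition push :: "(int \<Rightarrow> int) \<Rightarrow> rat series \<Rightarrow> rat series" where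
  "push \<phi> f = (\<lambda>m. \<Sum>m'\<in>{m'. image_mset \<phi> m' = m}. f m')"

lemma push_monomial_sum:
  assumes \<phi>: "\<And>j. finite {i. \<phi> i = j}" and T: "\<And>m. finite {t \<in> T. f t = m}"
  shows "push \<phi> (rat_series (monomial_sum T f)) = rat_series (monomial_sum T (\<lambda>t. image_mset \<phi> (f t)))"
proof
  fix m
  let ?P = "{m'. image_mset \<phi> m' = m}"
  have eq: "{t \<in> T. image_mset \<phi> (f t) = m} = (\<Union>m'\<in>?P. {t \<in> T. f t = m'})" by auto
  have "card {t \<in> T. image_mset \<phi> (f t) = m} = (\<Sum>m'\<in>?P. card {t \<in> T. f t = m'})"
    unfolding eq by (subst card_UN_disjoint) (auto simp: T finite_image_mset_vimage[OF \<phi>])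
  then show "push \<phi> (rat_series (monomial_sum T f)) m =
      rat_series (monomial_sum T (\<lambda>t. image_mset \<phi> (f t))) m"
    by (simp add: push_def rat_series_def monomial_sum_def)
qed

lemma push_add: "push \<phi> (\<lambda>m. f m + g m) = (\<lambda>m. push \<phi> f m + push \<phi> g m)"
  by (simp add: push_def sum.distrib)

lemma push_scale: "push \<phi> (scale_series q f) = scale_series q (push \<phi> f)"
  by (simp add: push_def scale_series_def sum_distrib_left)

text \<open>Both sides add \<open>f a' * g b'\<close> over all pairs whose sum maps to
  \<open>m\<close>, grouped once by \<open>a' + b'\<close> and once by the two images.\<close>

lemma push_mult:
  assumes \<phi>: "\<And>j. finite {i. \<phi> i = j}"
  shows "push \<phi> (series_mult f g) = series_mult (push \<phi> f) (push \<phi> g)"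
proof
  fix m
  note fin = finite_image_mset_vimage[OF \<phi>]
  let ?h = "\<lambda>(a', b'). f a' * g b'"
  have "push \<phi> (series_mult f g) m =
      sum ?h (\<Union>m'\<in>{m'. image_mset \<phi> m' = m}. {(a', b'). a' + b' = m'})"
    unfolding push_def series_mult_def
    by (subst sum.UNION_disjoint) (auto simp: fin finite_mset_splittings)
  also have "(\<Union>m'\<in>{m'. image_mset \<phi> m' = m}. {(a', b'). a' + b' = m'}) =
      (\<Union>(a, b)\<in>{(a, b). a + b = m}. {a'. image_mset \<phi> a' = a} \<times> {b'. image_mset \<phi> b' = b})"
    by auto
  also have "sum ?h \<dots> = (\<Sum>(a, b)\<in>{(a, b). a + b = m}.
      sum ?h ({a'. image_mset \<phi> a' = a} \<times> {b'. image_mset \<phi> b' = b}))"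
    by (subst sum.UNION_disjoint) (auto simp: fin finite_mset_splittings intro!: sum.cong)
  also have "\<dots> = series_mult (push \<phi> f) (push \<phi> g) m"
    unfolding push_def series_mult_def
    by (intro sum.cong) (auto simp: sum_product sum.cartesian_product)
  finally show "push \<phi> (series_mult f g) m = series_mult (push \<phi> f) (push \<phi> g) m" .
qed

text \<open>For odd \<open>N\<close> this is \<open>i / N\<close> rounded to the nearest integer.\<close>

definition round_div :: "nat \<Rightarrow> int \<Rightarrow> int" where
  "round_div N i = (i + int N div 2) div int N"

text \<open>With \<open>N = 2 * k + 1\<close> the half \<open>int N div 2\<close> is
  \<open>k\<close>, so the fibre is the block of radius \<open>k\<close> around
  \<open>N * j\<close>. Its symmetry is what makes \<open>round_div N\<close> an odd
  function.\<close>

lemma round_div_fibre: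
  assumes "odd N"
  shows "{i. round_div N i = j} = {int N * j - int N div 2 .. int N * j + int N div 2}"
proof -
  obtain k where N: "N = 2 * k + 1" using assms by (elim oddE)
  have half: "int N div 2 = int k" by (simp add: N)
  have "round_div N i = j \<longleftrightarrow> int N * j - int k \<le> i \<and> i \<le> int N * j + int k" (is "_ \<longleftrightarrow> ?R") for i
  proof
    assume "round_div N i = j"
    then have "i + int k = int N * j + (i + int k) mod int N"
      unfolding round_div_def half by (metis mult_div_mod_eq)
    moreover have "0 \<le> (i + int k) mod int N" "(i + int k) mod int N < int N" using N by auto
    ultimately show ?R using N by linarith
  next
    assume R: ?R
    then have "0 \<le> i + int k - int N * j" "i + int k - int N * j < int N" using N by auto
    then have "(i + int k - int N * j) div int N = 0" by auto
    moreover have "(int N * j + (i + int k - int N * j)) div int N =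
        j + (i + int k - int N * j) div int N"
      using N by (intro div_mult_self4) auto
    ultimately show "round_div N i = j" unfolding round_div_def half by (simp add: algebra_simps)
  qed
  then show ?thesis unfolding half by (simp add: set_eq_iff)
qed

lemma finite_round_div_fibre: "odd N \<Longrightarrow> finite {i. round_div N i = j}"
  by (simp add: round_div_fibre)

lemma card_round_div_fibre: "odd N \<Longrightarrow> card {i. round_div N i = j} = N"
  by (elim oddE) (simp add: round_div_fibre)

lemma round_div_minus:
  assumes "odd N" shows "round_div N (- i) = - round_div N i"
proof -
  have "i \<in> {i'. round_div N i' = round_div N i}" by simp
  then have "- i \<in> {i'. round_div N i' = - round_div N i}"
    unfolding round_div_fibre[OF assms] by (simp only: atLeastAtMost_iff) (simp add: algebra_simps)
  then show ?thesis by simp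
qed

lemma round_div_0 [simp]: "odd N \<Longrightarrow> round_div N 0 = 0"
  using round_div_minus[of N 0] by simp

lemma finite_power_sum_fibre:
  assumes "(a, b) \<noteq> (0, 0)"
  shows "finite {i :: int. replicate_mset a i + replicate_mset b (- i) = m}"
proof (rule finite_subset)
  show "{i. replicate_mset a i + replicate_mset b (- i) = m} \<subseteq> set_mset m \<union> uminus ` set_mset m"
  proof
    fix i assume "i \<in> {i. replicate_mset a i + replicate_mset b (- i) = m}"
    then have "set_mset m = (if a = 0 then {} else {i}) \<union> (if b = 0 then {} else {- i})"
      by (auto split: if_splits)
    then show "i \<in> set_mset m \<union> uminus ` set_mset m" using assms by (auto split: if_splits)
  qed
qed simp

text \<open>As \<open>round_div N\<close> commutes with negation, the monomial of \<open>i\<close>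
  becomes the monomial of \<open>round_div N i\<close>, and every index is hit by exactly
  \<open>N\<close> values of \<open>i\<close>.\<close>

lemma push_round_div_power_sum:
  assumes N: "odd N" and ab: "(a, b) \<noteq> (0, 0)"
  shows "push (round_div N) (rat_series (power_sum a b)) = scale_series (of_nat N) (rat_series (power_sum a b))"
proof
  fix m
  have eq: "{i. replicate_mset a (round_div N i) + replicate_mset b (- round_div N i) = m} =
      (\<Union>j\<in>{j. replicate_mset a j + replicate_mset b (- j) = m}. {i. round_div N i = j})" by auto
  have "card {i. replicate_mset a (round_div N i) + replicate_mset b (- round_div N i) = m} =
      card {j. replicate_mset a j + replicate_mset b (- j) = m} * N"
    unfolding eq using N ab
    by (subst card_UN_disjoint) (auto simp: card_round_div_fibre finite_round_div_fibre intro: finite_power_sum_fibre[OF ab, simplified])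
  then show "push (round_div N) (rat_series (power_sum a b)) m =
      scale_series (of_nat N) (rat_series (power_sum a b)) m"
    unfolding power_sum_def using N ab
    by (subst push_monomial_sum)
      (auto simp: finite_round_div_fibre finite_power_sum_fibre[OF ab, simplified] round_div_minus image_replicate_mset
         rat_series_def monomial_sum_def scale_series_def mult.commute)
qed

lemma x_zero_eq: "x_zero = monomial_sum {()} (\<lambda>_. {#0#})"
  by (auto simp: x_zero_def monomial_sum_def)

lemma series_one_eq: "series_one = rat_series (monomial_sum {()} (\<lambda>_. {#}))"
  by (auto simp: series_one_def monomial_sum_def rat_series_def)

lemma power_sum_commute: "power_sum a b = power_sum b a"
  unfolding power_sum_def
  by (rule monomial_sum_reindex[where g = uminus]) (auto simp: bij_uminus add.commute)

lemma size_power_sum: "power_sum a b m \<noteq> 0 \<Longrightarrow> size m = a + b"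
  by (auto simp: power_sum_def monomial_sum_def card_eq_0_iff)

section \<open>Invariance under signed permutations and the carrier of the ring\<close>

lemma act_monomial_sum:
  assumes "bij \<sigma>"
  shows "act \<sigma> (monomial_sum T f) = monomial_sum T (\<lambda>t. image_mset \<sigma> (f t))"
proof
  fix m
  have "f t = image_mset (inv_into UNIV \<sigma>) m \<longleftrightarrow> image_mset \<sigma> (f t) = m" for t
  proof -
    have "image_mset (inv_into UNIV \<sigma>) (image_mset \<sigma> k) = k" "image_mset \<sigma> (image_mset (inv_into UNIV \<sigma>) k) = k" for k
      using assms by (simp_all add: multiset.map_comp comp_def bij_is_inj bij_is_surj surj_f_inv_f)
    then show ?thesis by metis
  qed
  then show "act \<sigma> (monomial_sum T f) m = monomial_sum T (\<lambda>t. image_mset \<sigma> (f t)) m"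
    by (simp add: act_def monomial_sum_def)
qed

text \<open>Since all signed permutations are quantified over, the inverse in \<open>act\<close> can
  be moved to the other side, which leaves a condition without \<open>inv_into\<close>.\<close>

lemma SSym_int_iff:
  "f \<in> SSym_int \<longleftrightarrow> (\<exists>d. \<forall>m. f m \<noteq> 0 \<longrightarrow> size m \<le> d) \<and>
     (\<forall>\<sigma> m. signed_permutation \<sigma> \<longrightarrow> f (image_mset \<sigma> m) = f m)"
proof -
  have "(\<forall>\<sigma>. signed_permutation \<sigma> \<longrightarrow> act \<sigma> f = f) \<longleftrightarrow>
      (\<forall>\<sigma> m. signed_permutation \<sigma> \<longrightarrow> f (image_mset \<sigma> m) = f m)" (is "?L \<longleftrightarrow> ?R")
  proof
    assume L: ?L
    show ?R
    proof (intro allI impI)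
      fix \<sigma> m assume s: "signed_permutation \<sigma>"
      then have "bij \<sigma>" by (simp add: signed_permutation_def)
      then have "image_mset (inv_into UNIV \<sigma>) (image_mset \<sigma> m) = m"
        by (simp add: multiset.map_comp comp_def bij_is_inj)
      then show "f (image_mset \<sigma> m) = f m" using L s by (metis act_def)
    qed
  next
    assume R: ?R
    show ?L
    proof (intro allI impI ext)
      fix \<sigma> m assume s: "signed_permutation \<sigma>"
      then have "bij \<sigma>" by (simp add: signed_permutation_def)
      then have "image_mset \<sigma> (image_mset (inv_into UNIV \<sigma>) m) = m"
        by (simp add: multiset.map_comp comp_def bij_is_surj surj_f_inv_f)
      then show "act \<sigma> f m = f m" using R s by (metis act_def)
    qed
  qed
  then show ?thesis by (simp add: SSym_int_def)
qed

lemma x_zero_SSym_int: "x_zero \<in> SSym_int"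
proof -
  have "x_zero (image_mset \<sigma> m) = x_zero m" if "signed_permutation \<sigma>" for \<sigma> m
  proof -
    have "\<sigma> 0 = 0" "inj \<sigma>" using that by (auto simp: signed_permutation_def bij_is_inj dest: spec[of _ 0])
    then have "image_mset \<sigma> m = image_mset \<sigma> {#0#} \<longleftrightarrow> m = {#0#}"
      by (intro inj_eq multiset.inj_map)
    then have "image_mset \<sigma> m = {#0#} \<longleftrightarrow> m = {#0#}" using \<open>\<sigma> 0 = 0\<close> by simp
    then show ?thesis by (simp add: x_zero_def)
  qed
  moreover have "\<forall>m. x_zero m \<noteq> 0 \<longrightarrow> size m \<le> 1" by (auto simp: x_zero_def)
  ultimately show ?thesis unfolding SSym_int_iff by blast
qed

lemma power_sum_SSym_int: "power_sum a b \<in> SSym_int"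
proof -
  have "power_sum a b = act \<sigma> (power_sum a b)" if s: "signed_permutation \<sigma>" for \<sigma>
  proof -
    have "bij \<sigma>" using s by (simp add: signed_permutation_def)
    then show ?thesis unfolding power_sum_def
      by (subst act_monomial_sum, assumption, intro monomial_sum_reindex[where g = \<sigma>])
        (use s in \<open>auto simp: signed_permutation_def\<close>)
  qed
  moreover have "\<forall>m. power_sum a b m \<noteq> 0 \<longrightarrow> size m \<le> a + b"
    by (auto dest: size_power_sum)
  ultimately show ?thesis unfolding SSym_int_def by (intro CollectI conjI exI allI impI) (auto simp del: not_gr_zero)
qed

text \<open>Clearing a common denominator \<open>D\<close> recovers the integral series. The three
  conditions are intrinsic to \<open>f\<close>, so closure under sums and products can be checked on
  coefficients.\<close>

lemma carrier_SSym_rat_iff: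
  "f \<in> carrier SSym_rat \<longleftrightarrow> (\<exists>d. \<forall>m. f m \<noteq> 0 \<longrightarrow> size m \<le> d) \<and>
     (\<forall>\<sigma> m. signed_permutation \<sigma> \<longrightarrow> f (image_mset \<sigma> m) = f m) \<and>
     (\<exists>D::int. D \<noteq> 0 \<and> (\<forall>m. of_int D * f m \<in> \<int>))" (is "_ \<longleftrightarrow> ?B f \<and> ?I f \<and> ?D f")
proof
  assume "f \<in> carrier SSym_rat"
  then obtain q g where g: "g \<in> SSym_int" and f: "f = scale_series q (rat_series g)"
    by (auto simp: SSym_rat_def)
  obtain a b where q: "q = of_int a / of_int b" "b \<noteq> 0"
    by (metis Fract_of_int_quotient Rat_cases less_irrefl)
  have "?B f" "?I f" using g unfolding f SSym_int_iff by (auto simp: scale_series_def rat_series_def)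
  moreover have "of_int b * f m \<in> \<int>" for m
    using q by (simp add: f scale_series_def rat_series_def)
  ultimately show "?B f \<and> ?I f \<and> ?D f" using q by blast
next
  assume *: "?B f \<and> ?I f \<and> ?D f"
  then obtain D :: int where D: "D \<noteq> 0" "\<And>m. of_int D * f m \<in> \<int>" by blast
  then have "\<forall>m. \<exists>k. of_int D * f m = of_int k" by (auto elim!: Ints_cases)
  then obtain g where g: "\<And>m. of_int D * f m = of_int (g m)" by metis
  have gf: "f m = (1 / of_int D) * of_int (g m)" for m using g[of m] D by (simp add: field_simps)
  have "g m \<noteq> 0 \<Longrightarrow> f m \<noteq> 0" for m using gf D by simp
  moreover have "g (image_mset \<sigma> m) = g m" if "signed_permutation \<sigma>" for \<sigma> m
  proof -
    have "of_int (g (image_mset \<sigma> m)) = (of_int (g m) :: rat)" using * that by (simp flip: g)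
    then show ?thesis by simp
  qed
  ultimately have "g \<in> SSym_int" using * unfolding SSym_int_iff by blast
  moreover have "f = scale_series (1 / of_int D) (rat_series g)"
    using gf by (auto simp: scale_series_def rat_series_def)
  ultimately show "f \<in> carrier SSym_rat" by (auto simp: SSym_rat_def)
qed

lemma carrier_rat_series: "g \<in> SSym_int \<Longrightarrow> rat_series g \<in> carrier SSym_rat"
  unfolding SSym_rat_def by (auto simp: scale_series_def intro!: exI[of _ 1] exI[of _ g])

lemma carrier_one: "series_one \<in> carrier SSym_rat"
  unfolding carrier_SSym_rat_iff
  by (auto simp: series_one_def intro!: exI[of _ 0] exI[of _ 1])

lemma carrier_scale: "f \<in> carrier SSym_rat \<Longrightarrow> scale_series q f \<in> carrier SSym_rat"
  unfolding SSym_rat_def scale_series_def by (auto simp: mult.assoc[symmetric]) blast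

lemma carrier_add:
  assumes "f \<in> carrier SSym_rat" "g \<in> carrier SSym_rat"
  shows "(\<lambda>m. f m + g m) \<in> carrier SSym_rat"
proof -
  obtain d e D E where d: "\<forall>m. f m \<noteq> 0 \<longrightarrow> size m \<le> d" and e: "\<forall>m. g m \<noteq> 0 \<longrightarrow> size m \<le> e"
    and D: "(D::int) \<noteq> 0" "\<forall>m. of_int D * f m \<in> \<int>" and E: "(E::int) \<noteq> 0" "\<forall>m. of_int E * g m \<in> \<int>"
    using assms unfolding carrier_SSym_rat_iff by blast
  have "of_int (D * E) * (f m + g m) \<in> \<int>" for m
  proof -
    have "of_int (D * E) * (f m + g m) = of_int E * (of_int D * f m) + of_int D * (of_int E * g m)"
      by (simp add: algebra_simps)
    then show ?thesis using D E by simp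
  qed
  moreover have "f m + g m \<noteq> 0 \<longrightarrow> size m \<le> d + e" for m
    using d[rule_format, of m] e[rule_format, of m] by linarith
  moreover have "D * E \<noteq> 0" using D E by simp
  ultimately show ?thesis using assms unfolding carrier_SSym_rat_iff by metis
qed

lemma carrier_mult:
  assumes "f \<in> carrier SSym_rat" "g \<in> carrier SSym_rat"
  shows "series_mult f g \<in> carrier SSym_rat"
proof -
  obtain d e D E where d: "\<forall>m. f m \<noteq> 0 \<longrightarrow> size m \<le> d" and e: "\<forall>m. g m \<noteq> 0 \<longrightarrow> size m \<le> e"
    and D: "(D::int) \<noteq> 0" "\<forall>m. of_int D * f m \<in> \<int>" and E: "(E::int) \<noteq> 0" "\<forall>m. of_int E * g m \<in> \<int>"
    using assms unfolding carrier_SSym_rat_iff by blast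
  have "of_int (D * E) * series_mult f g m \<in> \<int>" for m
  proof -
    have "of_int (D * E) * series_mult f g m =
        (\<Sum>(a, b)\<in>{(a, b). a + b = m}. (of_int D * f a) * (of_int E * g b))"
      unfolding series_mult_def sum_distrib_left by (intro sum.cong) auto
    also have "\<dots> \<in> \<int>"
    proof (rule Ints_sum, clarify)
      fix a b
      show "(of_int D * f a) * (of_int E * g b) \<in> \<int>" using D E by (rule_tac Ints_mult) auto
    qed
    finally show ?thesis .
  qed
  moreover have "size m \<le> d + e" if "series_mult f g m \<noteq> 0" for m
  proof -
    obtain a b where "a + b = m" "f a * g b \<noteq> 0"
      using \<open>series_mult f g m \<noteq> 0\<close> unfolding series_mult_def
      by (rule sum.not_neutral_contains_not_neutral) auto
    then show ?thesis using d[rule_format, of a] e[rule_format, of b] by auto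
  qed
  moreover have "series_mult f g (image_mset \<sigma> m) = series_mult f g m" if s: "signed_permutation \<sigma>" for \<sigma> m
  proof -
    have inv: "f (image_mset \<sigma> a) = f a" "g (image_mset \<sigma> a) = g a" for a
      using assms s unfolding carrier_SSym_rat_iff by blast+
    have "inj \<sigma>" using s by (simp add: signed_permutation_def bij_is_inj)
    then have inj: "inj (image_mset \<sigma>)" by (simp add: multiset.inj_map)
    \<comment> \<open>A splitting of the image lifts to a splitting of \<open>m\<close>, uniquely as
      \<open>\<sigma>\<close> is injective, so the two convolution sums match term by term.\<close>
    have "bij_betw (\<lambda>(a, b). (image_mset \<sigma> a, image_mset \<sigma> b)) {(a, b). a + b = m}
        {(a, b). a + b = image_mset \<sigma> m}"
      unfolding bij_betw_def
    proof
      show "inj_on (\<lambda>(a, b). (image_mset \<sigma> a, image_mset \<sigma> b)) {(a, b). a + b = m}"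
        using inj by (auto simp: inj_on_def)
      show "(\<lambda>(a, b). (image_mset \<sigma> a, image_mset \<sigma> b)) ` {(a, b). a + b = m} = {(a, b). a + b = image_mset \<sigma> m}"
      proof (intro equalityI subsetI)
        fix p assume "p \<in> {(a, b). a + b = image_mset \<sigma> m}"
        then obtain a b where "p = (a, b)" "image_mset \<sigma> m = a + b" by auto
        moreover from image_mset_eq_plusD[OF this(2)] obtain a' b' where
          "m = a' + b'" "a = image_mset \<sigma> a'" "b = image_mset \<sigma> b'" by blast
        ultimately show "p \<in> (\<lambda>(a, b). (image_mset \<sigma> a, image_mset \<sigma> b)) ` {(a, b). a + b = m}"
          by (intro image_eqI[of _ _ "(a', b')"]) auto
      qed auto
    qed
    from sum.reindex_bij_betw[OF this, of "\<lambda>(a, b). f a * g b"]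
    show ?thesis by (simp add: series_mult_def inv case_prod_beta)
  qed
  moreover have "D * E \<noteq> 0" using D E by simp
  ultimately show ?thesis unfolding carrier_SSym_rat_iff by metis
qed

section \<open>Uniqueness and existence of the homomorphism\<close>

text \<open>The graph of the desired homomorphism, generated from its values on generators. A
  relation rather than a function, because the value is built along an expression for
  \<open>f\<close>, and its independence of the expression is a theorem
  (\<open>omega_rel_unique\<close>).\<close>

inductive omega_rel :: "rat series \<Rightarrow> rat series \<Rightarrow> bool" where
  one: "omega_rel series_one series_one"
| x_zero: "omega_rel (rat_series x_zero) (scale_series (- 1) (rat_series x_zero))"
| power_sum: "b \<le> a \<Longrightarrow> (a, b) \<noteq> (0, 0) \<Longrightarrow>
    omega_rel (rat_series (power_sum a b)) (scale_series ((- 1) ^ (a + b - 1)) (rat_series (power_sum a b)))"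
| add: "omega_rel f f' \<Longrightarrow> omega_rel g g' \<Longrightarrow> omega_rel (\<lambda>m. f m + g m) (\<lambda>m. f' m + g' m)"
| scale: "omega_rel f f' \<Longrightarrow> omega_rel (scale_series q f) (scale_series q f')"
| mult: "omega_rel f f' \<Longrightarrow> omega_rel g g' \<Longrightarrow> omega_rel (series_mult f g) (series_mult f' g')"

lemma omega_rel_carrier:
  assumes "omega_rel f f'" shows "f \<in> carrier SSym_rat \<and> f' \<in> carrier SSym_rat"
  using assms
  by induction (simp_all add: carrier_one carrier_scale carrier_add carrier_mult carrier_rat_series
      x_zero_SSym_int power_sum_SSym_int)

lemma omega_rel_power_sum:
  assumes "(a, b) \<noteq> (0, 0)"
  shows "omega_rel (rat_series (power_sum a b)) (scale_series ((- 1) ^ (a + b - 1)) (rat_series (power_sum a b)))"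
proof (cases "b \<le> a")
  case False
  then have "omega_rel (rat_series (power_sum b a)) (scale_series ((- 1) ^ (b + a - 1)) (rat_series (power_sum b a)))"
    by (intro omega_rel.power_sum) auto
  then show ?thesis by (simp add: power_sum_commute[of b a] add.commute)
qed (intro omega_rel.power_sum assms)

text \<open>Under the substitution \<open>x_zero\<close> is constant in \<open>N\<close> and a power
  sum is linear. Sums and convolutions of polynomials are polynomials, and
  (-1)^\<open>size m\<close> is multiplicative over splittings of \<open>m\<close>, so the sign rule
  only has to be checked on generators.\<close>

lemma omega_rel_interpolation:
  assumes "omega_rel f f'"
  obtains q :: "int multiset \<Rightarrow> rat poly" where
    "\<And>N m. odd N \<Longrightarrow> push (round_div N) f m = poly (q m) (of_nat N)"
    "\<And>m. f' m = (- 1) ^ size m * poly (q m) (- 1)"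
proof -
  have "\<exists>q :: int multiset \<Rightarrow> rat poly. (\<forall>N m. odd N \<longrightarrow> push (round_div N) f m = poly (q m) (of_nat N)) \<and>
      (\<forall>m. f' m = (- 1) ^ size m * poly (q m) (- 1))"
    using assms
  proof induction
    case one
    have "push (round_div N) series_one = series_one" if "odd N" for N
      unfolding series_one_eq using that by (subst push_monomial_sum) (auto simp: finite_round_div_fibre)
    then show ?case by (intro exI[of _ "\<lambda>m. [:series_one m:]"]) (auto simp: series_one_def)
  next
    case x_zero
    have "push (round_div N) (rat_series x_zero) = rat_series x_zero" if "odd N" for N
      unfolding x_zero_eq using that by (subst push_monomial_sum) (auto simp: finite_round_div_fibre)
    then show ?case
      by (intro exI[of _ "\<lambda>m. [:rat_series x_zero m:]"])
        (auto simp: rat_series_def x_zero_def scale_series_def)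
  next
    case (power_sum b a)
    have "scale_series ((- 1) ^ (a + b - 1)) (rat_series (power_sum a b)) m =
        (- 1) ^ size m * poly [:0, rat_series (power_sum a b) m:] (- 1)" for m
    proof (cases "power_sum a b m = 0")
      case False
      \<comment> \<open>Here \<open>(a, b) \<noteq> (0, 0)\<close> matters: it makes
        \<open>a + b - 1\<close> a true predecessor, so that one more factor - 1 gives the sign of
        the degree.\<close>
      then have "size m = Suc (a + b - 1)" using size_power_sum power_sum by fastforce
      then show ?thesis by (simp add: scale_series_def)
    qed (simp add: scale_series_def rat_series_def)
    then show ?case using power_sum
      by (intro exI[of _ "\<lambda>m. [:0, rat_series (power_sum a b) m:]"])
        (auto simp: push_round_div_power_sum scale_series_def mult.commute)
  next
    case (add f f' g g')
    then obtain q r :: "int multiset \<Rightarrow> rat poly" where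
      "\<forall>N m. odd N \<longrightarrow> push (round_div N) f m = poly (q m) (of_nat N)"
      "\<forall>m. f' m = (- 1) ^ size m * poly (q m) (- 1)"
      "\<forall>N m. odd N \<longrightarrow> push (round_div N) g m = poly (r m) (of_nat N)"
      "\<forall>m. g' m = (- 1) ^ size m * poly (r m) (- 1)" by blast
    then show ?case by (intro exI[of _ "\<lambda>m. q m + r m"]) (simp add: push_add algebra_simps)
  next
    case (scale f f' k)
    then obtain q :: "int multiset \<Rightarrow> rat poly" where
      "\<forall>N m. odd N \<longrightarrow> push (round_div N) f m = poly (q m) (of_nat N)"
      "\<forall>m. f' m = (- 1) ^ size m * poly (q m) (- 1)" by blast
    then show ?case
      by (intro exI[of _ "\<lambda>m. Polynomial.smult k (q m)"], simp only: push_scale)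
        (simp add: scale_series_def)
  next
    case (mult f f' g g')
    then obtain q r :: "int multiset \<Rightarrow> rat poly" where
      q: "\<forall>N m. odd N \<longrightarrow> push (round_div N) f m = poly (q m) (of_nat N)"
        "\<forall>m. f' m = (- 1) ^ size m * poly (q m) (- 1)" and
      r: "\<forall>N m. odd N \<longrightarrow> push (round_div N) g m = poly (r m) (of_nat N)"
        "\<forall>m. g' m = (- 1) ^ size m * poly (r m) (- 1)" by blast
    let ?s = "\<lambda>m. \<Sum>(a, b)\<in>{(a, b). a + b = m}. q a * r b"
    have "push (round_div N) (series_mult f g) m = poly (?s m) (of_nat N)" if "odd N" for N m
      using q r that
      by (subst push_mult) (auto simp: finite_round_div_fibre series_mult_def poly_sum intro!: sum.cong)
    moreover have "series_mult f' g' m = (- 1) ^ size m * poly (?s m) (- 1)" for m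
      unfolding series_mult_def poly_sum sum_distrib_left using q r
      by (intro sum.cong) (auto simp: power_add)
    ultimately show ?case by (intro exI[of _ ?s]) simp
  qed
  then show ?thesis using that by blast
qed

text \<open>The push-forwards depend on \<open>f\<close> alone, so two interpolating polynomials
  agree at all odd numbers, hence everywhere, in particular at - 1.\<close>

lemma omega_rel_unique:
  assumes f': "omega_rel f f'" and f'': "omega_rel f f''" shows "f' = f''"
proof
  fix m
  obtain q :: "int multiset \<Rightarrow> rat poly" where
    q: "\<And>N m. odd N \<Longrightarrow> push (round_div N) f m = poly (q m) (of_nat N)"
      "\<And>m. f' m = (- 1) ^ size m * poly (q m) (- 1)"
    using omega_rel_interpolation[OF f'] by blast
  obtain r :: "int multiset \<Rightarrow> rat poly" where
    r: "\<And>N m. odd N \<Longrightarrow> push (round_div N) f m = poly (r m) (of_nat N)"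
      "\<And>m. f'' m = (- 1) ^ size m * poly (r m) (- 1)"
    using omega_rel_interpolation[OF f''] by blast
  have "inj (\<lambda>k::nat. of_nat (2 * k + 1) :: rat)"
    by (rule injI) (simp only: of_nat_eq_iff)
  then have "infinite (range (\<lambda>k::nat. of_nat (2 * k + 1) :: rat))" by (rule range_inj_infinite)
  moreover have "range (\<lambda>k::nat. of_nat (2 * k + 1) :: rat) \<subseteq> {x. poly (q m - r m) x = 0}"
  proof clarify
    fix k :: nat
    show "poly (q m - r m) (of_nat (2 * k + 1)) = 0"
      using q(1)[of "2 * k + 1" m] r(1)[of "2 * k + 1" m] by simp
  qed
  ultimately have "infinite {x. poly (q m - r m) x = 0}" by (metis finite_subset)
  then have "q m - r m = 0" by (metis poly_roots_finite)
  then show "f' m = f'' m" using q r by simp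
qed

text \<open>A total and single-valued \<open>omega_rel\<close> is the graph of a map with the
  properties in the \<open>THE\<close>. Totality is a premise because its proof relies on the
  deletion-contraction results further down.\<close>

lemma omega_eqI_of_total:
  assumes total: "\<And>f. f \<in> carrier SSym_rat \<Longrightarrow> \<exists>f'. omega_rel f f'"
    and f: "omega_rel f f'"
  shows "omega f = f'"
proof -
  \<comment> \<open>The value \<open>undefined\<close> off the carrier is the one prescribed by the
    extensional function space, so it makes \<open>w\<close> the unique candidate there too.\<close>
  define w where "w f = (if f \<in> carrier SSym_rat then THE f'. omega_rel f f' else undefined)" for f
  have w: "w g = g'" if "omega_rel g g'" for g g'
  proof -
    have "(THE h. omega_rel g h) = g'"
      using that omega_rel_unique[OF _ that] by (rule the_equality)
    then show ?thesis using omega_rel_carrier[OF that] by (simp add: w_def)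
  qed
  have rel_w: "omega_rel g (w g)" if g: "g \<in> carrier SSym_rat" for g
  proof -
    obtain g' where g': "omega_rel g g'" using total[OF g] by blast
    then show ?thesis using w[OF g'] by simp
  qed
  have "omega = w" unfolding omega_def
  proof (rule the_equality)
    show "w \<in> carrier SSym_rat \<rightarrow>\<^sub>E carrier SSym_rat \<and>
      w \<in> ring_hom SSym_rat SSym_rat \<and>
      (\<forall>q. \<forall>f\<in>carrier SSym_rat. w (q \<odot>\<^bsub>SSym_rat\<^esub> f) = q \<odot>\<^bsub>SSym_rat\<^esub> w f) \<and>
      w (rat_series x_zero) = (- 1) \<odot>\<^bsub>SSym_rat\<^esub> rat_series x_zero \<and>
      (\<forall>a b. b \<le> a \<and> (a, b) \<noteq> (0, 0) \<longrightarrow>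
        w (rat_series (power_sum a b)) =
          ((- 1) ^ (a + b - 1)) \<odot>\<^bsub>SSym_rat\<^esub> rat_series (power_sum a b))"
    proof (intro conjI allI ballI impI)
      have wc: "w g \<in> carrier SSym_rat" if "g \<in> carrier SSym_rat" for g
        using rel_w[OF that] omega_rel_carrier by blast
      then show "w \<in> carrier SSym_rat \<rightarrow>\<^sub>E carrier SSym_rat" by (intro PiE_I) (simp_all add: w_def)
      show "w \<in> ring_hom SSym_rat SSym_rat"
      proof (rule ring_hom_memI)
        fix f g assume fg: "f \<in> carrier SSym_rat" "g \<in> carrier SSym_rat"
        show "w (f \<otimes>\<^bsub>SSym_rat\<^esub> g) = w f \<otimes>\<^bsub>SSym_rat\<^esub> w g"
          using w[OF omega_rel.mult[OF rel_w[OF fg(1)] rel_w[OF fg(2)]]] by simp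
        show "w (f \<oplus>\<^bsub>SSym_rat\<^esub> g) = w f \<oplus>\<^bsub>SSym_rat\<^esub> w g"
          using w[OF omega_rel.add[OF rel_w[OF fg(1)] rel_w[OF fg(2)]]] by simp
      next
        show "w \<one>\<^bsub>SSym_rat\<^esub> = \<one>\<^bsub>SSym_rat\<^esub>" using w[OF omega_rel.one] by simp
      qed (rule wc)
      show "w (q \<odot>\<^bsub>SSym_rat\<^esub> f) = q \<odot>\<^bsub>SSym_rat\<^esub> w f" if "f \<in> carrier SSym_rat" for q f
        using w[OF omega_rel.scale[OF rel_w[OF that]]] by simp
      show "w (rat_series x_zero) = (- 1) \<odot>\<^bsub>SSym_rat\<^esub> rat_series x_zero"
        using w[OF omega_rel.x_zero] by simp
      show "w (rat_series (power_sum a b)) =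
          ((- 1) ^ (a + b - 1)) \<odot>\<^bsub>SSym_rat\<^esub> rat_series (power_sum a b)"
        if "b \<le> a \<and> (a, b) \<noteq> (0, 0)" for a b
        using that by (subst w[OF omega_rel.power_sum]) simp_all
    qed
  next
    fix v
    assume v: "v \<in> carrier SSym_rat \<rightarrow>\<^sub>E carrier SSym_rat \<and>
      v \<in> ring_hom SSym_rat SSym_rat \<and>
      (\<forall>q. \<forall>f\<in>carrier SSym_rat. v (q \<odot>\<^bsub>SSym_rat\<^esub> f) = q \<odot>\<^bsub>SSym_rat\<^esub> v f) \<and>
      v (rat_series x_zero) = (- 1) \<odot>\<^bsub>SSym_rat\<^esub> rat_series x_zero \<and>
      (\<forall>a b. b \<le> a \<and> (a, b) \<noteq> (0, 0) \<longrightarrow>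
        v (rat_series (power_sum a b)) =
          ((- 1) ^ (a + b - 1)) \<odot>\<^bsub>SSym_rat\<^esub> rat_series (power_sum a b))"
    then have v_x: "v (rat_series x_zero) = scale_series (- 1) (rat_series x_zero)"
      and v_p: "\<And>a b. b \<le> a \<Longrightarrow> (a, b) \<noteq> (0, 0) \<Longrightarrow> v (rat_series (power_sum a b)) =
        scale_series ((- 1) ^ (a + b - 1)) (rat_series (power_sum a b))"
      and v_s: "\<And>q f. f \<in> carrier SSym_rat \<Longrightarrow> v (scale_series q f) = scale_series q (v f)"
      by simp_all
    have hom: "v \<in> ring_hom SSym_rat SSym_rat" using v by blast
    \<comment> \<open>A homomorphism with the prescribed values on generators is determined along
      every derivation of \<open>omega_rel\<close>.\<close>
    have "v g = g'" if "omega_rel g g'" for g g'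
      using that
    proof induction
      case one
      show ?case using ring_hom_one[OF hom] by simp
    next
      case (add f f' g g')
      then show ?case using ring_hom_add[OF hom, of f g] omega_rel_carrier[of f f'] omega_rel_carrier[of g g'] by simp
    next
      case (mult f f' g g')
      then show ?case using ring_hom_mult[OF hom, of f g] omega_rel_carrier[of f f'] omega_rel_carrier[of g g'] by simp
    next
      case (scale f f' q)
      then show ?case using v_s omega_rel_carrier[of f f'] by simp
    qed (intro v_x v_p; assumption)+
    then have "v g = w g" if "g \<in> carrier SSym_rat" for g using rel_w[OF that] by simp
    moreover have "v g = w g" if "g \<notin> carrier SSym_rat" for g
      using PiE_arb[OF conjunct1[OF v] that] that by (simp add: w_def)
    ultimately show "v = w" by (intro ext) metis
  qed
  then show ?thesis using w f by simp
qed

section \<open>Sign lists and forms of type B\<close>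

text \<open>The point \<open>z\<close> lies in an open chamber and \<open>x\<close> in its closure,
  hence one strict and one weak inequality on the side named by \<open>e\<close>.\<close>

definition sides :: "('a \<Rightarrow> real) \<Rightarrow> 'a \<Rightarrow> 'a \<Rightarrow> bool \<Rightarrow> bool" where
  "sides f z x e \<longleftrightarrow> (if e then f z > 0 \<and> f x \<ge> 0 else f z < 0 \<and> f x \<le> 0)"

text \<open>A sign list in \<open>signs L x\<close> stands for a chamber of the central arrangement of
  the kernels of \<open>L\<close> whose closure contains \<open>x\<close>.\<close>

definition signs :: "(('v \<Rightarrow> real) \<Rightarrow> real) list \<Rightarrow> ('v \<Rightarrow> real) \<Rightarrow> bool list set" where
  "signs L x = {s. \<exists>z. list_all2 (\<lambda>f. sides f z x) L s}"

text \<open>One equation for both additivity and homogeneity, in the shape needed for moving a point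
  in a direction or along a segment.\<close>

definition linear_form :: "(('v \<Rightarrow> real) \<Rightarrow> real) \<Rightarrow> bool" where
  "linear_form f \<longleftrightarrow> (\<forall>x y t. f (\<lambda>v. x v + t * y v) = f x + t * f y)"

lemma finite_list_all2: "finite {s :: bool list. \<exists>z. Q z \<and> list_all2 (P z) L s}"
proof (rule finite_subset)
  show "{s. \<exists>z. Q z \<and> list_all2 (P z) L s} \<subseteq> {s. set s \<subseteq> UNIV \<and> length s = length L}"
    by (auto dest: list_all2_lengthD)
qed (rule finite_lists_length_eq, simp)

text \<open>Only the strict inequalities at \<open>z\<close> are affected by the move. There are
  finitely many, so a common radius exists.\<close>

lemma sides_perturb:
  assumes "\<forall>f\<in>set L. linear_form f" "list_all2 (\<lambda>f. sides f z x) L s"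
  shows "\<exists>\<epsilon>>0. \<forall>t. \<bar>t\<bar> < \<epsilon> \<longrightarrow> list_all2 (\<lambda>f. sides f (\<lambda>v. z v + t * y v) x) L s"
  using assms(2,1)
proof (induction rule: list_all2_induct)
  case Nil
  show ?case by (intro exI[of _ 1]) simp
next
  case (Cons f L e s)
  then obtain \<epsilon> where \<epsilon>: "\<epsilon> > 0"
    "\<And>t. \<bar>t\<bar> < \<epsilon> \<Longrightarrow> list_all2 (\<lambda>f. sides f (\<lambda>v. z v + t * y v) x) L s" by auto
  have nz: "f z \<noteq> 0" using Cons by (auto simp: sides_def split: if_splits)
  \<comment> \<open>The summand 1 avoids division by 0 and still gives
    \<open>\<bar>t * f y\<bar> < \<bar>f z\<bar>\<close>.\<close>
  let ?\<delta> = "\<bar>f z\<bar> / (1 + \<bar>f y\<bar>)"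
  have "sides f (\<lambda>v. z v + t * y v) x e" if "\<bar>t\<bar> < ?\<delta>" for t
  proof -
    have "\<bar>t * f y\<bar> \<le> \<bar>t\<bar> * (1 + \<bar>f y\<bar>)" by (simp add: abs_mult mult_left_mono)
    also have "\<dots> < \<bar>f z\<bar>" using that by (simp add: pos_less_divide_eq add_pos_nonneg)
    finally have "\<bar>t * f y\<bar> < \<bar>f z\<bar>" .
    moreover have "f (\<lambda>v. z v + t * y v) = f z + t * f y"
      using Cons.prems by (simp add: linear_form_def)
    ultimately show ?thesis using Cons.hyps by (auto simp: sides_def split: if_splits)
  qed
  moreover have "?\<delta> > 0" using nz by (simp add: add_pos_nonneg)
  ultimately show ?case using \<epsilon> by (intro exI[of _ "min \<epsilon> ?\<delta>"]) simp
qed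

lemma sides_convex:
  assumes f: "linear_form f" and s: "sides f z x e" "sides f z' x e" and t: "0 \<le> t" "t \<le> 1"
  shows "sides f (\<lambda>v. z v + t * (z' v + (- 1) * z v)) x e"
proof -
  \<comment> \<open>The difference of the points is spelled with \<open>(- 1) *\<close> so that it
    is itself an instance of the pattern in \<open>linear_form\<close>.\<close>
  have "f (\<lambda>v. z v + t * (z' v + (- 1) * z v)) = f z + t * f (\<lambda>v. z' v + (- 1) * z v)"
    by (rule f[unfolded linear_form_def, rule_format])
  also have "f (\<lambda>v. z' v + (- 1) * z v) = f z' + (- 1) * f z"
    by (rule f[unfolded linear_form_def, rule_format])
  finally have eq: "f (\<lambda>v. z v + t * (z' v + (- 1) * z v)) = (1 - t) * f z + t * f z'"
    by (simp add: algebra_simps)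
  have "0 < (1 - t) * p + t * q" if "0 < p" "0 < q" for p q :: real
  proof (cases "t = 0")
    case False
    then have "0 < t * q" "0 \<le> (1 - t) * p" using t that by simp_all
    then show ?thesis by linarith
  qed (use that in simp)
  from this[of "f z" "f z'"] this[of "- f z" "- f z'"] show ?thesis
    using s unfolding sides_def eq by (auto split: if_splits)
qed

text \<open>Split by the first sign. If \<open>f x \<noteq> 0\<close>, every sign list of
  \<open>L\<close> extends in exactly one way. If \<open>f x = 0\<close>, every list extends in at
  least one way, and in two ways exactly when its chamber meets the kernel of \<open>f\<close>; so
  the surplus counts the chambers of the restriction to that kernel.\<close>

lemma card_signs_Cons:
  assumes lin: "\<forall>g\<in>set (f # L). linear_form g" and y: "f y \<noteq> 0"
  shows "card (signs (f # L) x) = card (signs L x) +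
    (if f x = 0 then card {s. \<exists>z. f z = 0 \<and> list_all2 (\<lambda>g. sides g z x) L s} else 0)"
proof -
  define A where "A e = {s. \<exists>z. sides f z x e \<and> list_all2 (\<lambda>g. sides g z x) L s}" for e
  have finA: "finite (A e)" for e unfolding A_def by (rule finite_list_all2)
  have "signs (f # L) x = (#) True ` A True \<union> (#) False ` A False"
  proof (intro equalityI subsetI)
    fix s assume "s \<in> signs (f # L) x"
    then obtain e s' where "s = e # s'" "s' \<in> A e" by (auto simp: signs_def A_def list_all2_Cons1)
    then show "s \<in> (#) True ` A True \<union> (#) False ` A False" by (cases e) auto
  qed (auto simp: signs_def A_def)
  moreover have "card (\<dots>) = card (A True) + card (A False)"
    using finA by (subst card_Un_disjoint) (auto simp: card_image)
  ultimately have card: "card (signs (f # L) x) = card (A True) + card (A False)" by simp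
  have sub: "A e \<subseteq> signs L x" for e by (auto simp: A_def signs_def)
  have shift: "f (\<lambda>v. z v + t * y' v) = f z + t * f y'" for z t y'
    using lin by (simp add: linear_form_def)
  show ?thesis
  proof (cases "f x = 0")
    case True
    let ?R = "{s. \<exists>z. f z = 0 \<and> list_all2 (\<lambda>g. sides g z x) L s}"
    have perturb: "\<exists>z'. f z' > 0 \<and> list_all2 (\<lambda>g. sides g z' x) L s"
      "\<exists>z'. f z' < 0 \<and> list_all2 (\<lambda>g. sides g z' x) L s"
      if z: "f z = 0" "list_all2 (\<lambda>g. sides g z x) L s" for z s
    proof -
      obtain \<epsilon> where \<epsilon>: "\<epsilon> > 0"
        "\<forall>t. \<bar>t\<bar> < \<epsilon> \<longrightarrow> list_all2 (\<lambda>f. sides f (\<lambda>v. z v + t * y v) x) L s"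
        using sides_perturb[of L z x s y] lin z by auto
      \<comment> \<open>The sign makes \<open>t * f y\<close> positive, so that \<open>t\<close> and
        \<open>- t\<close> lead from the kernel to its two sides.\<close>
      define t where "t = (if f y > 0 then \<epsilon> / 2 else - (\<epsilon> / 2))"
      have "t * f y > 0" using y \<epsilon> by (auto simp: t_def not_less mult_pos_neg)
      moreover have "\<bar>t\<bar> < \<epsilon>" "\<bar>- t\<bar> < \<epsilon>" using \<epsilon> by (auto simp: t_def)
      ultimately show "\<exists>z'. f z' > 0 \<and> list_all2 (\<lambda>g. sides g z' x) L s"
        "\<exists>z'. f z' < 0 \<and> list_all2 (\<lambda>g. sides g z' x) L s"
        using \<epsilon>(2)[rule_format, of t] \<epsilon>(2)[rule_format, of "- t"] z
          shift[of z t y] shift[of z "- t" y]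
        by (intro exI[of _ "\<lambda>v. z v + t * y v"], simp, intro exI[of _ "\<lambda>v. z v + - t * y v"], simp)
    qed
    have "A True \<union> A False = signs L x"
    proof (intro equalityI subsetI)
      fix s assume "s \<in> signs L x"
      then obtain z where z: "list_all2 (\<lambda>g. sides g z x) L s" by (auto simp: signs_def)
      consider "f z > 0" | "f z < 0" | "f z = 0" by linarith
      then show "s \<in> A True \<union> A False"
        using z True perturb(1)[OF _ z] by cases (auto simp: A_def sides_def)
    qed (use sub in auto)
    moreover have "A True \<inter> A False = ?R"
    proof (intro equalityI subsetI)
      fix s assume "s \<in> A True \<inter> A False"
      then obtain z z' where z: "f z > 0" "list_all2 (\<lambda>g. sides g z x) L s"
        and z': "f z' < 0" "list_all2 (\<lambda>g. sides g z' x) L s" by (auto simp: A_def sides_def)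
      \<comment> \<open>The parameter at which the segment from \<open>z\<close> to
        \<open>z'\<close> crosses the kernel of \<open>f\<close>; by convexity the crossing point
        keeps all signs in \<open>s\<close>.\<close>
      define t where "t = f z / (f z - f z')"
      have t: "0 \<le> t" "t \<le> 1" using z z' by (auto simp: t_def divide_simps)
      let ?z = "\<lambda>v. z v + t * (z' v + (- 1) * z v)"
      have "f ?z = f z + t * f (\<lambda>v. z' v + (- 1) * z v)" by (rule shift)
      also have "\<dots> = f z + t * (f z' + (- 1) * f z)" by (simp only: shift)
      also have "\<dots> = 0" using z z' by (simp add: t_def field_simps)
      finally have "f ?z = 0" .
      moreover have "list_all2 (\<lambda>g. sides g ?z x) L s"
        unfolding list_all2_conv_all_nth
      proof (intro conjI allI impI)
        show "length L = length s" using z(2) by (rule list_all2_lengthD)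
        fix i assume i: "i < length L"
        show "sides (L ! i) ?z x (s ! i)"
          using lin i list_all2_nthD[OF z(2) i] list_all2_nthD[OF z'(2) i] by (intro sides_convex t) auto
      qed
      ultimately show "s \<in> ?R" by blast
    qed (use perturb True in \<open>auto simp: A_def sides_def\<close>)
    ultimately show ?thesis using card True card_Un_Int[OF finA finA, of True False] by simp
  next
    case False
    define e where "e = (f x > 0)"
    have "A (\<not> e) = {}" using False by (auto simp: A_def sides_def e_def split: if_splits)
    moreover have "signs L x \<subseteq> A e"
    proof
      fix s assume "s \<in> signs L x"
      then obtain z where z: "list_all2 (\<lambda>g. sides g z x) L s" by (auto simp: signs_def)
      \<comment> \<open>Large enough for \<open>t * f x\<close> to outweigh \<open>f z\<close>.
        Moving in direction \<open>x\<close> preserves the other signs, since \<open>x\<close> lies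
        weakly on the same sides as \<open>z\<close>.\<close>
      define t where "t = (\<bar>f z\<bar> + 1) / \<bar>f x\<bar>"
      have t: "t > 0" using False by (simp add: t_def add_nonneg_pos)
      let ?z = "\<lambda>v. z v + t * x v"
      have "t * f x = (if e then \<bar>f z\<bar> + 1 else - (\<bar>f z\<bar> + 1))"
        using False by (auto simp: t_def e_def)
      then have "sides f ?z x e" unfolding sides_def shift using False by (auto simp: e_def)
      moreover have "list_all2 (\<lambda>g. sides g ?z x) L s"
      proof -
        have "sides g ?z x e'" if "g \<in> set L" "sides g z x e'" for g e'
        proof -
          have "g ?z = g z + t * g x" using lin that by (simp add: linear_form_def)
          then show ?thesis
            using that t by (auto simp: sides_def add_pos_nonneg add_neg_nonpos mult_nonneg_nonpos split: if_splits)
        qed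
        then show ?thesis using z by (simp add: list_all2_conv_all_nth)
      qed
      ultimately show "s \<in> A e" by (auto simp: A_def)
    qed
    ultimately show ?thesis using card False sub[of e] by (cases e) auto
  qed
qed

definition type_B_forms :: "'v set \<Rightarrow> (('v \<Rightarrow> real) \<Rightarrow> real) set" where
  "type_B_forms U = {\<lambda>z. p * z u + q * z v | p q u v.
     p \<in> {- 1, 0, 1} \<and> q \<in> {- 1, 0, 1} \<and> (p = 0 \<or> u \<in> U) \<and> (q = 0 \<or> v \<in> U)}"

lemma linear_form_type_B: "f \<in> type_B_forms U \<Longrightarrow> linear_form f"
  by (auto simp: type_B_forms_def linear_form_def algebra_simps)

text \<open>Up to a scalar, a nonzero form is a coordinate or a sum or difference of two. Solving
  for \<open>z u\<close> gives a factor \<open>t\<close>, where \<open>t = 0\<close> is the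
  coordinate hyperplane and \<open>w\<close> a dummy.\<close>

lemma type_B_form_kernel:
  assumes "f \<in> type_B_forms U" "f y \<noteq> 0"
  obtains u w and t :: int where "u \<in> U" "t \<in> {- 1, 0, 1}" "t = 0 \<or> w \<in> U \<and> w \<noteq> u"
    "\<And>z. f z = 0 \<longleftrightarrow> z u = of_int t * z w"
proof -
  obtain p q u v where f: "f = (\<lambda>z. p * z u + q * z v)" and p: "p \<in> {- 1, 0, 1}" "p = 0 \<or> u \<in> U"
    and q: "q \<in> {- 1, 0, 1}" "q = 0 \<or> v \<in> U"
    using assms(1) unfolding type_B_forms_def by blast
  consider "u = v" "p + q \<noteq> 0" | "p = 0" "q \<noteq> 0" | "q = 0" "p \<noteq> 0" | "u \<noteq> v" "p \<noteq> 0" "q \<noteq> 0"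
  proof -
    have "u = v \<Longrightarrow> p + q \<noteq> 0"
    proof
      assume "u = v" "p + q = 0"
      have "f y = (p + q) * y u" unfolding f \<open>u = v\<close> by (simp add: distrib_right)
      then show False using assms(2) \<open>p + q = 0\<close> by simp
    qed
    moreover have "p \<noteq> 0 \<or> q \<noteq> 0" using assms(2) unfolding f by auto
    ultimately show ?thesis using that by blast
  qed
  then show thesis
  proof cases
    case 1
    then have "f z = (p + q) * z u" for z unfolding f by (simp add: distrib_right)
    moreover have "u \<in> U" using 1 p q by auto
    ultimately show ?thesis using 1 that[of u 0 u] by simp
  next
    case 2
    then show ?thesis using q that[of v 0 v] unfolding f by simp
  next
    case 3
    then show ?thesis using p that[of u 0 u] unfolding f by simp
  next
    case 4
    \<comment> \<open>With two coefficients that are 1 or - 1, equal ones give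
      \<open>z u = - z v\<close> and opposite ones \<open>z u = z v\<close>.\<close>
    define t :: int where "t = (if p = q then - 1 else 1)"
    have "f z = 0 \<longleftrightarrow> z u = of_int t * z v" for z
      using 4 p q unfolding f t_def by (elim insertE emptyE; auto)
    then show ?thesis using 4 p q that[of u t v] by (simp add: t_def)
  qed
qed

text \<open>Parametrizes the hyperplane \<open>z u = t * z w\<close> by the remaining coordinates.
  It is polymorphic so that it acts on real points and on integer points alike.\<close>

definition substitute :: "'v \<Rightarrow> int \<Rightarrow> 'v \<Rightarrow> ('v \<Rightarrow> 'a) \<Rightarrow> 'v \<Rightarrow> 'a :: comm_ring_1" where
  "substitute u t w z = z(u := of_int t * z w)"

lemma type_B_form_substitute:
  assumes f: "f \<in> type_B_forms U" and t: "t \<in> {- 1, 0, 1}" "t = 0 \<or> w \<in> U \<and> w \<noteq> u"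
  shows "(\<lambda>z. f (substitute u t w z)) \<in> type_B_forms (U - {u})"
proof -
  have monom: "\<exists>p' j. p' \<in> {- 1, 0, 1} \<and> (p' = 0 \<or> j \<in> U - {u}) \<and>
      (\<forall>z. p * substitute u t w z i = p' * z j)"
    if "p \<in> {- 1, 0, 1 :: real}" "p = 0 \<or> i \<in> U" for p i
  proof (cases "i = u")
    case True
    then show ?thesis using that t
      by (intro exI[of _ "p * of_int t"] exI[of _ w]) (auto simp: substitute_def)
  next
    case False
    then show ?thesis using that by (intro exI[of _ p] exI[of _ i]) (auto simp: substitute_def)
  qed
  obtain p q i j where f: "f = (\<lambda>z. p * z i + q * z j)" and p: "p \<in> {- 1, 0, 1}" "p = 0 \<or> i \<in> U"
    and q: "q \<in> {- 1, 0, 1}" "q = 0 \<or> j \<in> U"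
    using f unfolding type_B_forms_def by blast
  from monom[OF p] monom[OF q] obtain p' i' q' j' where
    "p' \<in> {- 1, 0, 1} \<and> (p' = 0 \<or> i' \<in> U - {u})" "\<forall>z. p * substitute u t w z i = p' * z i'"
    "q' \<in> {- 1, 0, 1} \<and> (q' = 0 \<or> j' \<in> U - {u})" "\<forall>z. q * substitute u t w z j = q' * z j'" by blast
  then show ?thesis unfolding f type_B_forms_def
    by (intro CollectI exI[of _ p'] exI[of _ q'] exI[of _ i'] exI[of _ j']) simp
qed

text \<open>The substitution is a projection onto the kernel of \<open>f\<close>: its values lie
  there, and it fixes the points of the kernel. Witnesses in the kernel are thus the same as
  substituted witnesses.\<close>

lemma card_signs_restrict:
  assumes ker: "\<And>z. f z = 0 \<longleftrightarrow> z u = of_int t * z w" and t: "t = 0 \<or> w \<noteq> u"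
  shows "{s. \<exists>z. f z = 0 \<and> list_all2 (\<lambda>g. sides g z (substitute u t w x)) L s} =
    signs (map (\<lambda>g z. g (substitute u t w z)) L) x"
proof -
  have fixed: "substitute u t w z = z" if "f z = 0" for z
    using that unfolding ker substitute_def by (simp add: fun_eq_iff)
  have sub: "f (substitute u t w z) = 0" for z
    using t unfolding ker substitute_def by auto
  have "(\<exists>z. f z = 0 \<and> list_all2 (\<lambda>g. sides g z (substitute u t w x)) L s) \<longleftrightarrow>
    (\<exists>z. list_all2 (\<lambda>g. sides g (substitute u t w z) (substitute u t w x)) L s)" for s
  proof
    assume "\<exists>z. f z = 0 \<and> list_all2 (\<lambda>g. sides g z (substitute u t w x)) L s"
    then obtain z where "f z = 0" "list_all2 (\<lambda>g. sides g z (substitute u t w x)) L s" by blast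
    then show "\<exists>z. list_all2 (\<lambda>g. sides g (substitute u t w z) (substitute u t w x)) L s"
      by (intro exI[of _ z]) (simp add: fixed)
  qed (use sub in blast)
  moreover have "sides (\<lambda>z. g (substitute u t w z)) z x e =
      sides g (substitute u t w z) (substitute u t w x) e" for g z e
    by (simp add: sides_def)
  ultimately show ?thesis by (simp add: signs_def list_all2_map1)
qed

section \<open>Deletion and contraction\<close>

text \<open>After contractions a vertex \<open>u\<close> stands for a class of old vertices:
  \<open>a u\<close> of them carry its coordinate and \<open>b u\<close> the negative of it. The
  class with coordinate 0 has \<open>c\<close> members.\<close>

definition weighted_monomial :: "'v set \<Rightarrow> nat \<Rightarrow> ('v \<Rightarrow> nat) \<Rightarrow> ('v \<Rightarrow> nat) \<Rightarrow> ('v \<Rightarrow> int) \<Rightarrow> int multiset" where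
  "weighted_monomial U c a b \<alpha> = replicate_mset c 0 +
     (\<Sum>u\<in>U. replicate_mset (a u) (\<alpha> u) + replicate_mset (b u) (- \<alpha> u))"

definition open_points :: "'v set \<Rightarrow> (('v \<Rightarrow> real) \<Rightarrow> real) list \<Rightarrow> ('v \<Rightarrow> int) set" where
  "open_points U L = {\<alpha> \<in> U \<rightarrow>\<^sub>E UNIV. \<forall>f\<in>set L. f (of_int \<circ> \<alpha>) \<noteq> 0}"

definition open_series :: "'v set \<Rightarrow> nat \<Rightarrow> ('v \<Rightarrow> nat) \<Rightarrow> ('v \<Rightarrow> nat) \<Rightarrow>
    (('v \<Rightarrow> real) \<Rightarrow> real) list \<Rightarrow> int series" where
  "open_series U c a b L = monomial_sum (open_points U L) (weighted_monomial U c a b)"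

text \<open>Summation over points comes first, each weighted by the number of closed chambers
  through it, so that the recursion can be proved point by point.\<close>

definition closed_series :: "'v set \<Rightarrow> nat \<Rightarrow> ('v \<Rightarrow> nat) \<Rightarrow> ('v \<Rightarrow> nat) \<Rightarrow>
    (('v \<Rightarrow> real) \<Rightarrow> real) list \<Rightarrow> int series" where
  "closed_series U c a b L = (\<lambda>m. \<Sum>\<alpha>\<in>{\<alpha> \<in> U \<rightarrow>\<^sub>E UNIV. weighted_monomial U c a b \<alpha> = m}.
     int (card (signs L (of_int \<circ> \<alpha>))))"

section \<open>Weighted monomials and the series without forms\<close>

lemma replicate_mset_add: "replicate_mset (m + n) x = replicate_mset m x + replicate_mset n x"
  by (rule multiset_eqI) simp

lemma weighted_monomial_cong:
  "(\<And>u. u \<in> U \<Longrightarrow> \<alpha> u = \<beta> u) \<Longrightarrow> weighted_monomial U c a b \<alpha> = weighted_monomial U c a b \<beta>"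
  by (simp add: weighted_monomial_def)

lemma finite_weighted_monomial_fibre:
  assumes U: "finite U" and ab: "\<forall>u\<in>U. (a u, b u) \<noteq> (0, 0)"
  shows "finite {\<alpha> \<in> U \<rightarrow>\<^sub>E UNIV. weighted_monomial U c a b \<alpha> = m}"
proof (rule finite_subset)
  show "{\<alpha> \<in> U \<rightarrow>\<^sub>E UNIV. weighted_monomial U c a b \<alpha> = m} \<subseteq>
      U \<rightarrow>\<^sub>E (set_mset m \<union> uminus ` set_mset m)"
  proof (clarify, intro PiE_I)
    fix \<alpha> u assume u: "u \<in> U" and \<alpha>: "\<alpha> \<in> U \<rightarrow>\<^sub>E (UNIV :: int set)"
    have "set_mset (replicate_mset (a u) (\<alpha> u) + replicate_mset (b u) (- \<alpha> u))
        \<subseteq> set_mset (weighted_monomial U c a b \<alpha>)"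
      unfolding weighted_monomial_def set_mset_union[of "replicate_mset c 0"] set_mset_sum[OF U]
      using u by blast
    then show "\<alpha> u \<in> set_mset (weighted_monomial U c a b \<alpha>) \<union>
        uminus ` set_mset (weighted_monomial U c a b \<alpha>)"
      using ab u by (auto split: if_splits intro: image_eqI[of _ _ "- \<alpha> u"])
  qed auto
qed (use U in \<open>auto intro: finite_PiE\<close>)

lemma series_mult_scale:
  "series_mult (scale_series p f) (scale_series q g) = scale_series (p * q) (series_mult f g)"
  by (auto simp: series_mult_def scale_series_def sum_distrib_left intro!: sum.cong)

lemma omega_rel_zero: "omega_rel (\<lambda>m. 0) (\<lambda>m. 0)"
  using omega_rel.scale[OF omega_rel.one, of 0] by (simp add: scale_series_def)

lemma omega_rel_diff:
  assumes "omega_rel f f'" "omega_rel g g'"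
  shows "omega_rel (\<lambda>m. f m - g m) (\<lambda>m. f' m - g' m)"
  using omega_rel.add[OF assms(1) omega_rel.scale[OF assms(2), of "- 1"]]
  by (simp add: scale_series_def)

lemma omega_rel_x_zero_power:
  "omega_rel (rat_series (monomial_sum {()} (\<lambda>_. replicate_mset c 0)))
     (scale_series ((- 1) ^ c) (rat_series (monomial_sum {()} (\<lambda>_. replicate_mset c 0))))"
proof (induction c)
  case 0
  show ?case using omega_rel.one by (simp add: series_one_eq scale_series_def)
next
  case (Suc c)
  let ?f = "rat_series (monomial_sum {()} (\<lambda>_. replicate_mset c 0))"
  have "series_mult (rat_series x_zero) ?f =
      rat_series (monomial_sum ({()} \<times> {()}) (\<lambda>(t, s). {#0#} + replicate_mset c 0))"
    unfolding x_zero_eq by (rule series_mult_monomial_sum) auto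
  also have "monomial_sum ({()} \<times> {()}) (\<lambda>(t, s). {#0#} + replicate_mset c 0) =
      monomial_sum {()} (\<lambda>_. replicate_mset (Suc c) 0)"
    by (rule monomial_sum_reindex[where g = "\<lambda>t. (t, t)"]) (auto simp: bij_betw_def)
  finally show ?case
    using omega_rel.mult[OF omega_rel.x_zero Suc] by (simp add: series_mult_scale)
qed

text \<open>The coordinates vary independently, so the series is a power of \<open>x_zero\<close>
  times one power sum per vertex. Each power sum has a sign exponent one below its degree, whence
  \<open>card U\<close>.\<close>

lemma omega_rel_no_forms:
  assumes "finite U" "\<forall>u\<in>U. (a u, b u) \<noteq> (0, 0)"
  shows "omega_rel (rat_series (monomial_sum (U \<rightarrow>\<^sub>E UNIV) (weighted_monomial U c a b)))
    (scale_series ((- 1) ^ (c + (\<Sum>u\<in>U. a u + b u) + card U))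
      (rat_series (monomial_sum (U \<rightarrow>\<^sub>E UNIV) (weighted_monomial U c a b))))"
  using assms
proof (induction U rule: finite_induct)
  case empty
  have "monomial_sum ({} \<rightarrow>\<^sub>E UNIV) (weighted_monomial {} c a b) = monomial_sum {()} (\<lambda>_. replicate_mset c 0)"
    \<comment> \<open>Over the empty set there is exactly one extensional function, the constant
      \<open>undefined\<close>.\<close>
    by (rule monomial_sum_reindex[where g = "\<lambda>_ _. undefined"])
      (auto simp: bij_betw_def weighted_monomial_def)
  then show ?case using omega_rel_x_zero_power by simp
next
  case (insert u U)
  let ?f = "rat_series (monomial_sum (U \<rightarrow>\<^sub>E UNIV) (weighted_monomial U c a b))"
  have ab: "(a u, b u) \<noteq> (0, 0)" using insert by auto
  have "bij_betw (\<lambda>(i, \<alpha>). \<alpha>(u := i)) (UNIV \<times> (U \<rightarrow>\<^sub>E UNIV)) (insert u U \<rightarrow>\<^sub>E UNIV)"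
    using insert.hyps
    by (intro bij_betw_byWitness[where f' = "\<lambda>\<beta>. (\<beta> u, \<beta>(u := undefined))"])
      (auto simp: PiE_iff extensional_def fun_eq_iff split: if_splits)
  then have "monomial_sum (insert u U \<rightarrow>\<^sub>E UNIV) (weighted_monomial (insert u U) c a b) =
      monomial_sum (UNIV \<times> (U \<rightarrow>\<^sub>E UNIV))
        (\<lambda>(i, \<alpha>). (replicate_mset (a u) i + replicate_mset (b u) (- i)) + weighted_monomial U c a b \<alpha>)"
  proof (rule monomial_sum_reindex, clarify)
    fix i and \<alpha> :: "'a \<Rightarrow> int"
    have "weighted_monomial U c a b (\<alpha>(u := i)) = weighted_monomial U c a b \<alpha>"
      using insert.hyps by (intro weighted_monomial_cong) auto
    then show "replicate_mset (a u) i + replicate_mset (b u) (- i) + weighted_monomial U c a b \<alpha> =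
        weighted_monomial (insert u U) c a b (\<alpha>(u := i))"
      using insert.hyps by (simp add: weighted_monomial_def)
  qed
  then have eq: "rat_series (monomial_sum (insert u U \<rightarrow>\<^sub>E UNIV) (weighted_monomial (insert u U) c a b)) =
      series_mult (rat_series (power_sum (a u) (b u))) ?f"
    unfolding power_sum_def using insert
    by (subst series_mult_monomial_sum)
      (simp_all add: finite_power_sum_fibre[OF ab, simplified] finite_weighted_monomial_fibre[simplified])
  obtain k where k: "a u + b u = Suc k" using ab by (cases "a u + b u") auto
  have "(\<Sum>v\<in>insert u U. a v + b v) = Suc k + (\<Sum>v\<in>U. a v + b v)"
    using insert.hyps k by simp
  then have "(- 1) ^ (a u + b u - 1) * (- 1) ^ (c + (\<Sum>v\<in>U. a v + b v) + card U) =
      ((- 1) ^ (c + (\<Sum>v\<in>insert u U. a v + b v) + card (insert u U)) :: rat)"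
    using insert.hyps k by (simp add: power_add)
  then show ?case
    unfolding eq using omega_rel.mult[OF omega_rel_power_sum[OF ab] insert.IH] insert.prems
    by (simp add: series_mult_scale)
qed

section \<open>The two recursions\<close>

lemma substitute_of_int: "of_int \<circ> substitute u t w \<alpha> = substitute u t w (of_int \<circ> \<alpha>)"
  by (auto simp: substitute_def)

text \<open>The general \<open>h\<close> serves twice in \<open>contract_weights\<close>, for the
  monomials and for the degrees.\<close>

lemma sum_fun_upd2:
  assumes "finite A" "w \<in> A"
  shows "(\<Sum>v\<in>A. h ((a(w := x)) v) ((b(w := y)) v) v) = h x y w + (\<Sum>v\<in>A - {w}. h (a v) (b v) v)"
proof -
  have "(\<Sum>v\<in>A - {w}. h ((a(w := x)) v) ((b(w := y)) v) v) = (\<Sum>v\<in>A - {w}. h (a v) (b v) v)"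
    by (intro sum.cong) auto
  then show ?thesis using sum.remove[OF assms, of "\<lambda>v. h ((a(w := x)) v) ((b(w := y)) v) v"] by simp
qed

text \<open>For \<open>t = 0\<close> the weights of \<open>u\<close> pass to the power of
  \<open>x_zero\<close>; otherwise they are added to those of \<open>w\<close>. Nothing is lost, so
  the total degree is kept and no weight pair becomes \<open>(0, 0)\<close>.\<close>

lemma contract_weights:
  assumes U: "finite U" "u \<in> U" and t: "t \<in> {- 1, 0, 1 :: int}" "t = 0 \<or> w \<in> U \<and> w \<noteq> u"
    and ab: "\<forall>u\<in>U. (a u, b u) \<noteq> (0, 0)"
  obtains c' a' b' where
    "\<And>\<alpha>. weighted_monomial U c a b (substitute u t w \<alpha>) = weighted_monomial (U - {u}) c' a' b' \<alpha>"
    "c' + (\<Sum>v\<in>U - {u}. a' v + b' v) = c + (\<Sum>v\<in>U. a v + b v)"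
    "\<forall>v\<in>U - {u}. (a' v, b' v) \<noteq> (0, 0)"
proof -
  let ?m = "\<lambda>a b (\<alpha> :: 'a \<Rightarrow> int) v. replicate_mset (a v) (\<alpha> v) + replicate_mset (b v) (- \<alpha> v)"
  have rest: "weighted_monomial U c a b (substitute u t w \<alpha>) = replicate_mset c 0 +
      (replicate_mset (a u) (t * \<alpha> w) + replicate_mset (b u) (- t * \<alpha> w)) + (\<Sum>v\<in>U - {u}. ?m a b \<alpha> v)" for \<alpha>
  proof -
    have "(\<Sum>v\<in>U - {u}. ?m a b (substitute u t w \<alpha>) v) = (\<Sum>v\<in>U - {u}. ?m a b \<alpha> v)"
      by (intro sum.cong) (auto simp: substitute_def)
    then show ?thesis
      unfolding weighted_monomial_def sum.remove[OF U, of "?m a b (substitute u t w \<alpha>)"]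
      by (simp add: substitute_def add_ac)
  qed
  show thesis
  proof (cases "t = 0")
    case True
    show ?thesis
    proof (rule that[of "c + a u + b u" a b])
      show "weighted_monomial U c a b (substitute u t w \<alpha>) = weighted_monomial (U - {u}) (c + a u + b u) a b \<alpha>" for \<alpha>
        unfolding rest by (simp add: True replicate_mset_add weighted_monomial_def add_ac)
    qed (use ab U in \<open>simp_all add: sum.remove[of U u]\<close>)
  next
    case False
    then have w: "w \<in> U - {u}" using t by auto
    \<comment> \<open>For \<open>t = - 1\<close> the coordinate of \<open>u\<close> is the negative
      of that of \<open>w\<close>, so the two weights swap.\<close>
    define p q where "p = (if t = 1 then a u else b u)" and "q = (if t = 1 then b u else a u)"
    have fin: "finite (U - {u})" using U by simp
    note upd = sum_fun_upd2[OF fin w, where a = a and b = b and x = "a w + p" and y = "b w + q"]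
    show ?thesis
    proof (rule that[of c "a(w := a w + p)" "b(w := b w + q)"])
      fix \<alpha>
      have pq: "replicate_mset p (\<alpha> w) + replicate_mset q (- \<alpha> w) =
          replicate_mset (a u) (t * \<alpha> w) + replicate_mset (b u) (- t * \<alpha> w)"
        using t False by (auto simp: p_def q_def)
      have "weighted_monomial (U - {u}) c (a(w := a w + p)) (b(w := b w + q)) \<alpha> = replicate_mset c 0 +
          (?m a b \<alpha> w + (replicate_mset p (\<alpha> w) + replicate_mset q (- \<alpha> w)) + (\<Sum>v\<in>U - {u} - {w}. ?m a b \<alpha> v))"
        unfolding weighted_monomial_def
          upd[of "\<lambda>k l v. replicate_mset k (\<alpha> v) + replicate_mset l (- \<alpha> v)"]
        by (simp only: replicate_mset_add add_ac)
      then show "weighted_monomial U c a b (substitute u t w \<alpha>) =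
          weighted_monomial (U - {u}) c (a(w := a w + p)) (b(w := b w + q)) \<alpha>"
        unfolding rest pq sum.remove[OF fin w, of "?m a b \<alpha>"] by (simp only: add_ac)
    next
      have "p + q = a u + b u" by (simp add: p_def q_def)
      then show "c + (\<Sum>v\<in>U - {u}. (a(w := a w + p)) v + (b(w := b w + q)) v) = c + (\<Sum>v\<in>U. a v + b v)"
        unfolding upd[of "\<lambda>k l v. k + l"] sum.remove[OF U, of "\<lambda>v. a v + b v"]
          sum.remove[OF fin w, of "\<lambda>v. a v + b v"] by linarith
    next
      show "\<forall>v\<in>U - {u}. ((a(w := a w + p)) v, (b(w := b w + q)) v) \<noteq> (0, 0)"
        using ab by auto
    qed
  qed
qed

lemma bij_betw_filter:
  assumes "bij_betw g A B" "\<And>x. x \<in> A \<Longrightarrow> P x \<longleftrightarrow> Q (g x)"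
  shows "bij_betw g {x \<in> A. P x} {y \<in> B. Q y}"
proof -
  have B: "B = g ` A" and inj: "inj_on g A" using assms(1) by (simp_all add: bij_betw_def)
  have "g ` {x \<in> A. P x} = {y \<in> B. Q y}"
  proof (intro equalityI subsetI)
    fix y assume "y \<in> {y \<in> B. Q y}"
    then obtain x where "x \<in> A" "y = g x" "Q y" unfolding B by blast
    then show "y \<in> g ` {x \<in> A. P x}" using assms(2)[of x] by simp
  qed (use assms(2) in \<open>auto simp: B\<close>)
  then show ?thesis using inj_on_subset[OF inj, of "{x \<in> A. P x}"] by (simp add: bij_betw_def)
qed

text \<open>The factor \<open>t\<close> is an integer, so the coordinate at \<open>u\<close> is
  again integral. The inverse forgets it by resetting it to \<open>undefined\<close>, as
  extensionality demands.\<close>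

lemma bij_betw_substitute:
  assumes u: "u \<in> U" and t: "t = 0 \<or> w \<in> U \<and> w \<noteq> u"
  shows "bij_betw (substitute u t w) ((U - {u}) \<rightarrow>\<^sub>E (UNIV :: int set)) {\<alpha> \<in> U \<rightarrow>\<^sub>E UNIV. \<alpha> u = t * \<alpha> w}"
proof (rule bij_betw_byWitness[where f' = "\<lambda>\<beta>. \<beta>(u := undefined)"]; intro ballI subsetI; (elim imageE CollectE conjE)?)
  fix \<alpha> :: "'a \<Rightarrow> int" assume "\<alpha> \<in> U - {u} \<rightarrow>\<^sub>E UNIV"
  then have "\<alpha> u = undefined" by (rule PiE_arb) simp
  then show "(substitute u t w \<alpha>)(u := undefined) = \<alpha>" by (simp add: substitute_def fun_upd_idem)
next
  fix \<alpha> :: "'a \<Rightarrow> int" assume "\<alpha> u = t * \<alpha> w"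
  then have "\<alpha>(u := t * \<alpha> w) = \<alpha>" by (metis fun_upd_triv)
  moreover have "t * (\<alpha>(u := undefined)) w = t * \<alpha> w" using t by auto
  ultimately show "substitute u t w (\<alpha>(u := undefined)) = \<alpha>"
    by (simp only: substitute_def fun_upd_upd of_int_eq_id id_apply)
next
  fix \<beta> \<alpha> :: "'a \<Rightarrow> int" assume \<beta>: "\<beta> = substitute u t w \<alpha>" and "\<alpha> \<in> U - {u} \<rightarrow>\<^sub>E UNIV"
  then have "\<beta> \<in> U \<rightarrow>\<^sub>E UNIV"
    using u by (auto simp: substitute_def PiE_iff extensional_def)
  moreover have "\<beta> u = t * \<beta> w" using t unfolding \<beta> substitute_def by auto
  ultimately show "\<beta> \<in> {\<alpha> \<in> U \<rightarrow>\<^sub>E UNIV. \<alpha> u = t * \<alpha> w}" by blast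
next
  fix \<beta> \<alpha> :: "'a \<Rightarrow> int" assume "\<beta> = \<alpha>(u := undefined)" "\<alpha> \<in> U \<rightarrow>\<^sub>E UNIV"
  then show "\<beta> \<in> U - {u} \<rightarrow>\<^sub>E UNIV" by (auto simp: PiE_iff extensional_def)
qed

lemma open_series_Cons:
  assumes U: "finite U" and ab: "\<forall>u\<in>U. (a u, b u) \<noteq> (0, 0)" and u: "u \<in> U" and t: "t = 0 \<or> w \<in> U \<and> w \<noteq> u"
    and ker: "\<And>z. f z = 0 \<longleftrightarrow> z u = of_int t * z w"
    and wm: "\<And>\<alpha>. weighted_monomial U c a b (substitute u t w \<alpha>) = weighted_monomial (U - {u}) c' a' b' \<alpha>"
  shows "open_series U c a b (f # L) m =
    open_series U c a b L m - open_series (U - {u}) c' a' b' (map (\<lambda>g z. g (substitute u t w z)) L) m"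
proof -
  let ?A = "{\<alpha> \<in> open_points U L. weighted_monomial U c a b \<alpha> = m}"
  let ?Z = "{\<alpha> \<in> ?A. f (of_int \<circ> \<alpha>) = 0}"
  have ker_int: "f (of_int \<circ> \<alpha>) = 0 \<longleftrightarrow> \<alpha> u = t * \<alpha> w" for \<alpha>
    unfolding ker comp_apply by (simp flip: of_int_mult)
  have fin: "finite ?A"
    by (rule finite_subset[OF _ finite_weighted_monomial_fibre[OF U ab, of c m]]) (auto simp: open_points_def)
  have sub: "?Z \<subseteq> ?A" by blast
  then have finZ: "finite ?Z" using fin by (rule finite_subset)
  have diff: "{\<alpha> \<in> open_points U (f # L). weighted_monomial U c a b \<alpha> = m} = ?A - ?Z"
    by (auto simp: open_points_def)
  have eq: "open_series U c a b (f # L) m = int (card ?A) - int (card ?Z)"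
    unfolding open_series_def monomial_sum_def
    by (simp only: diff card_Diff_subset[OF finZ sub] of_nat_diff[OF card_mono[OF fin sub]])
  \<comment> \<open>The deleted points are carried over to open points of the contraction, with
    equal monomials.\<close>
  have "bij_betw (substitute u t w)
      {\<alpha> \<in> (U - {u}) \<rightarrow>\<^sub>E UNIV. (\<forall>g\<in>set L. g (substitute u t w (of_int \<circ> \<alpha>)) \<noteq> 0) \<and>
        weighted_monomial (U - {u}) c' a' b' \<alpha> = m}
      {\<alpha> \<in> {\<alpha> \<in> U \<rightarrow>\<^sub>E UNIV. \<alpha> u = t * \<alpha> w}. (\<forall>g\<in>set L. g (of_int \<circ> \<alpha>) \<noteq> 0) \<and>
        weighted_monomial U c a b \<alpha> = m}"
    by (rule bij_betw_filter[OF bij_betw_substitute[OF u t]]) (simp add: wm substitute_of_int)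
  moreover have "{\<alpha> \<in> {\<alpha> \<in> U \<rightarrow>\<^sub>E UNIV. \<alpha> u = t * \<alpha> w}. (\<forall>g\<in>set L. g (of_int \<circ> \<alpha>) \<noteq> 0) \<and>
      weighted_monomial U c a b \<alpha> = m} = ?Z"
    by (auto simp: open_points_def ker_int)
  moreover have "{\<alpha> \<in> (U - {u}) \<rightarrow>\<^sub>E UNIV. (\<forall>g\<in>set L. g (substitute u t w (of_int \<circ> \<alpha>)) \<noteq> 0) \<and>
        weighted_monomial (U - {u}) c' a' b' \<alpha> = m} =
      {\<alpha> \<in> open_points (U - {u}) (map (\<lambda>g z. g (substitute u t w z)) L). weighted_monomial (U - {u}) c' a' b' \<alpha> = m}"
    by (auto simp: open_points_def)
  ultimately have "card ?Z = card {\<alpha> \<in> open_points (U - {u}) (map (\<lambda>g z. g (substitute u t w z)) L).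
      weighted_monomial (U - {u}) c' a' b' \<alpha> = m}" by (simp only: bij_betw_same_card)
  with eq show ?thesis by (simp add: open_series_def monomial_sum_def)
qed

text \<open>Apply \<open>card_signs_Cons\<close> at every point: the surplus appears only on the
  kernel of \<open>f\<close>, where \<open>card_signs_restrict\<close> identifies it with a count
  for the contraction.\<close>

lemma closed_series_Cons:
  assumes U: "finite U" and ab: "\<forall>u\<in>U. (a u, b u) \<noteq> (0, 0)" and u: "u \<in> U" and t: "t = 0 \<or> w \<in> U \<and> w \<noteq> u"
    and ker: "\<And>z. f z = 0 \<longleftrightarrow> z u = of_int t * z w"
    and wm: "\<And>\<alpha>. weighted_monomial U c a b (substitute u t w \<alpha>) = weighted_monomial (U - {u}) c' a' b' \<alpha>"
    and lin: "\<forall>g\<in>set (f # L). linear_form g" and y: "f y \<noteq> 0"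
  shows "closed_series U c a b (f # L) m =
    closed_series U c a b L m + closed_series (U - {u}) c' a' b' (map (\<lambda>g z. g (substitute u t w z)) L) m"
proof -
  let ?L' = "map (\<lambda>g z. g (substitute u t w z)) L"
  let ?A = "{\<alpha> \<in> U \<rightarrow>\<^sub>E UNIV. weighted_monomial U c a b \<alpha> = m}"
  let ?B = "{\<alpha> \<in> (U - {u}) \<rightarrow>\<^sub>E UNIV. weighted_monomial (U - {u}) c' a' b' \<alpha> = m}"
  let ?R = "\<lambda>x. {s. \<exists>z. f z = 0 \<and> list_all2 (\<lambda>g. sides g z x) L s}"
  have ker_int: "f (of_int \<circ> \<alpha>) = 0 \<longleftrightarrow> \<alpha> u = t * \<alpha> w" for \<alpha>
    unfolding ker comp_apply by (simp flip: of_int_mult)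
  have fin: "finite ?A" by (rule finite_weighted_monomial_fibre[OF U ab])
  have "bij_betw (substitute u t w) ?B {\<alpha> \<in> {\<alpha> \<in> U \<rightarrow>\<^sub>E UNIV. \<alpha> u = t * \<alpha> w}. weighted_monomial U c a b \<alpha> = m}"
    by (rule bij_betw_filter[OF bij_betw_substitute[OF u t]]) (simp add: wm)
  also have "{\<alpha> \<in> {\<alpha> \<in> U \<rightarrow>\<^sub>E UNIV. \<alpha> u = t * \<alpha> w}. weighted_monomial U c a b \<alpha> = m} =
      {\<alpha> \<in> ?A. f (of_int \<circ> \<alpha>) = 0}" by (auto simp: ker_int)
  finally have bij: "bij_betw (substitute u t w) ?B {\<alpha> \<in> ?A. f (of_int \<circ> \<alpha>) = 0}" .
  have "closed_series U c a b (f # L) m = closed_series U c a b L m +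
      (\<Sum>\<alpha>\<in>?A. if f (of_int \<circ> \<alpha>) = 0 then int (card (?R (of_int \<circ> \<alpha>))) else 0)"
    unfolding closed_series_def sum.distrib[symmetric]
  proof (rule sum.cong[OF refl])
    fix \<alpha>
    show "int (card (signs (f # L) (of_int \<circ> \<alpha>))) = int (card (signs L (of_int \<circ> \<alpha>))) +
        (if f (of_int \<circ> \<alpha>) = 0 then int (card (?R (of_int \<circ> \<alpha>))) else 0)"
      by (cases "f (of_int \<circ> \<alpha>) = 0")
        (simp_all only: card_signs_Cons[OF lin y] if_True if_False of_nat_add of_nat_0 simp_thms)
  qed
  also have "(\<Sum>\<alpha>\<in>?A. if f (of_int \<circ> \<alpha>) = 0 then int (card (?R (of_int \<circ> \<alpha>))) else 0) =
      (\<Sum>\<alpha>\<in>{\<alpha> \<in> ?A. f (of_int \<circ> \<alpha>) = 0}. int (card (?R (of_int \<circ> \<alpha>))))"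
    by (rule sum.inter_filter[OF fin, symmetric])
  also have "\<dots> = (\<Sum>\<alpha>\<in>?B. int (card (?R (of_int \<circ> substitute u t w \<alpha>))))"
    by (rule sum.reindex_bij_betw[OF bij, symmetric])
  also have "\<dots> = closed_series (U - {u}) c' a' b' ?L' m"
  proof -
    have t': "t = 0 \<or> w \<noteq> u" using t by blast
    show ?thesis unfolding closed_series_def substitute_of_int by (simp only: card_signs_restrict[OF ker t'])
  qed
  finally show ?thesis .
qed

lemma omega_rel_open_series:
  assumes "finite U" "\<forall>u\<in>U. (a u, b u) \<noteq> (0, 0)" "set L \<subseteq> type_B_forms U"
  shows "omega_rel (rat_series (open_series U c a b L))
    (scale_series ((- 1) ^ (c + (\<Sum>u\<in>U. a u + b u) + card U)) (rat_series (closed_series U c a b L)))"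
  using assms
\<comment> \<open>Induction is on the length because the contracted list is a \<open>map\<close> of
  the tail, over other vertices and weights.\<close>
proof (induction "length L" arbitrary: L U c a b)
  case 0
  then have [simp]: "L = []" by simp
  have "open_series U c a b [] = monomial_sum (U \<rightarrow>\<^sub>E UNIV) (weighted_monomial U c a b)"
    by (simp add: open_series_def open_points_def)
  moreover have "closed_series U c a b [] = monomial_sum (U \<rightarrow>\<^sub>E UNIV) (weighted_monomial U c a b)"
    by (simp add: closed_series_def monomial_sum_def signs_def)
  ultimately show ?case using omega_rel_no_forms[OF 0(2,3)] by simp
next
  case (Suc n L\<^sub>1)
  then obtain f L where L\<^sub>1: "L\<^sub>1 = f # L" and n: "n = length L" by (cases L\<^sub>1) auto
  note prems = Suc.prems[unfolded L\<^sub>1]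
  show ?case
  proof (cases "\<exists>y. f y \<noteq> 0")
    \<comment> \<open>A zero form has no open point and no strict side, so both series
      vanish.\<close>
    case False
    then have "open_series U c a b (f # L) = (\<lambda>_. 0)" "closed_series U c a b (f # L) = (\<lambda>_. 0)"
      by (simp_all add: fun_eq_iff open_series_def open_points_def monomial_sum_def closed_series_def signs_def
          list_all2_Cons1 sides_def)
    then show ?thesis using omega_rel_zero unfolding L\<^sub>1 by (simp add: rat_series_def scale_series_def)
  next
    case True
    then obtain y where y: "f y \<noteq> 0" by blast
    have "f \<in> type_B_forms U" using prems by simp
    then obtain u w and t :: int where u: "u \<in> U" and t: "t \<in> {- 1, 0, 1}" "t = 0 \<or> w \<in> U \<and> w \<noteq> u"
      and ker: "\<And>z. f z = 0 \<longleftrightarrow> z u = of_int t * z w" using y by (rule type_B_form_kernel) blast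
    from prems(1) u t prems(2) obtain c' a' b' where
      wm: "\<And>\<alpha>. weighted_monomial U c a b (substitute u t w \<alpha>) = weighted_monomial (U - {u}) c' a' b' \<alpha>" and
      deg: "c' + (\<Sum>v\<in>U - {u}. a' v + b' v) = c + (\<Sum>v\<in>U. a v + b v)" and
      ab': "\<forall>v\<in>U - {u}. (a' v, b' v) \<noteq> (0, 0)"
      by (rule contract_weights[where c = c]) blast
    let ?L' = "map (\<lambda>g z. g (substitute u t w z)) L"
    let ?sgn = "(- 1) ^ (c + (\<Sum>v\<in>U. a v + b v) + card U) :: rat"
    have lin: "\<forall>g\<in>set (f # L). linear_form g" using prems(3) linear_form_type_B by blast
    have L': "set ?L' \<subseteq> type_B_forms (U - {u})"
    proof -
      have "(\<lambda>z. g (substitute u t w z)) \<in> type_B_forms (U - {u})" if "g \<in> set L" for g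
        using prems(3) that by (intro type_B_form_substitute[OF _ t]) auto
      then show ?thesis by (simp add: image_subset_iff)
    qed
    have "card U = Suc (card (U - {u}))" using card_Suc_Diff1[OF prems(1) u] by simp
    then have sgn: "(- 1) ^ (c' + (\<Sum>v\<in>U - {u}. a' v + b' v) + card (U - {u})) = - ?sgn"
      unfolding deg by simp
    have 1: "omega_rel (rat_series (open_series U c a b L)) (scale_series ?sgn (rat_series (closed_series U c a b L)))"
      using prems by (intro Suc.hyps(1)) (simp_all add: n)
    have 2: "omega_rel (rat_series (open_series (U - {u}) c' a' b' ?L'))
        (scale_series (- ?sgn) (rat_series (closed_series (U - {u}) c' a' b' ?L')))"
      unfolding sgn[symmetric] using prems(1) ab' L' by (intro Suc.hyps(1)) (simp_all add: n)
    show ?thesis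
      using omega_rel_diff[OF 1 2] unfolding L\<^sub>1 rat_series_def scale_series_def
      by (simp add: open_series_Cons[OF prems(1,2) u t(2) ker wm]
          closed_series_Cons[OF prems(1,2) u t(2) ker wm lin y] algebra_simps)
  qed
qed

section \<open>Orbit sums and totality\<close>

lemma signed_permutation_comp:
  "signed_permutation \<tau> \<Longrightarrow> signed_permutation \<sigma> \<Longrightarrow> signed_permutation (\<tau> \<circ> \<sigma>)"
  by (auto simp: signed_permutation_def intro: bij_comp)

lemma signed_permutation_0: "signed_permutation \<sigma> \<Longrightarrow> \<sigma> 0 = 0"
  unfolding signed_permutation_def by (metis add.inverse_neutral neg_equal_zero)

lemma signed_permutation_abs_eq:
  assumes "signed_permutation \<sigma>" "\<bar>\<sigma> i\<bar> = \<bar>\<sigma> j\<bar>" shows "\<bar>i\<bar> = \<bar>j\<bar>"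
proof -
  have "\<sigma> i = \<sigma> j \<or> \<sigma> i = \<sigma> (- j)" using assms by (auto simp: signed_permutation_def abs_eq_iff)
  moreover have "inj \<sigma>" using assms by (simp add: signed_permutation_def bij_is_inj)
  ultimately have "i = j \<or> i = - j" by (simp add: inj_eq)
  then show ?thesis by auto
qed

text \<open>Oddness forces - x and - y to be exchanged as well. The order of the tests also covers
  \<open>y = x\<close> and \<open>y = - x\<close>, where the map is the identity or one sign
  change.\<close>

lemma signed_transposition:
  assumes "x \<noteq> 0" "y \<noteq> 0"
  obtains \<tau> where "signed_permutation \<tau>" "\<tau> x = y" "\<And>z. \<bar>z\<bar> \<noteq> \<bar>x\<bar> \<Longrightarrow> \<bar>z\<bar> \<noteq> \<bar>y\<bar> \<Longrightarrow> \<tau> z = z"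
proof -
  define \<tau> where "\<tau> z = (if z = x then y else if z = y then x
    else if z = - x then - y else if z = - y then - x else z)" for z
  have "\<tau> (\<tau> z) = z" for z using assms by (auto simp: \<tau>_def)
  then have "bij \<tau>" by (intro o_bij[of \<tau>]) auto
  moreover have "\<tau> (- z) = - \<tau> z" for z using assms by (auto simp: \<tau>_def)
  ultimately have "signed_permutation \<tau>" by (simp add: signed_permutation_def)
  moreover have "\<tau> x = y" "\<And>z. \<bar>z\<bar> \<noteq> \<bar>x\<bar> \<Longrightarrow> \<bar>z\<bar> \<noteq> \<bar>y\<bar> \<Longrightarrow> \<tau> z = z"
    by (auto simp: \<tau>_def)
  ultimately show thesis using that by blast
qed

text \<open>Add one index at a time, correcting its image by a signed transposition. The values
  already placed differ in absolute value from both exchanged points and stay fixed.\<close>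

lemma signed_permutation_extend:
  assumes "finite U" "\<forall>u\<in>U. 0 < u" "\<forall>u\<in>U. \<alpha> u \<noteq> 0"
    "\<forall>u\<in>U. \<forall>v\<in>U. u \<noteq> v \<longrightarrow> \<bar>\<alpha> u\<bar> \<noteq> \<bar>\<alpha> v\<bar>"
  shows "\<exists>\<sigma>. signed_permutation \<sigma> \<and> (\<forall>u\<in>U. \<sigma> u = \<alpha> u)"
  using assms
proof (induction U rule: finite_induct)
  case empty
  show ?case by (intro exI[of _ id]) (simp add: signed_permutation_def bij_id[unfolded id_def] id_def)
next
  case (insert u U)
  then obtain \<sigma> where \<sigma>: "signed_permutation \<sigma>" "\<forall>v\<in>U. \<sigma> v = \<alpha> v" by auto
  have "\<sigma> u \<noteq> 0"
    using signed_permutation_abs_eq[OF \<sigma>(1), of u 0] signed_permutation_0[OF \<sigma>(1)] insert.prems by auto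
  then obtain \<tau> where \<tau>: "signed_permutation \<tau>" "\<tau> (\<sigma> u) = \<alpha> u"
    "\<And>z. \<bar>z\<bar> \<noteq> \<bar>\<sigma> u\<bar> \<Longrightarrow> \<bar>z\<bar> \<noteq> \<bar>\<alpha> u\<bar> \<Longrightarrow> \<tau> z = z"
    using signed_transposition[of "\<sigma> u" "\<alpha> u"] insert.prems by auto
  have "\<tau> (\<sigma> v) = \<alpha> v" if v: "v \<in> U" for v
  proof -
    have "\<bar>v\<bar> \<noteq> \<bar>u\<bar>" using insert.prems(1) insert.hyps v by auto
    then have "\<bar>\<sigma> v\<bar> \<noteq> \<bar>\<sigma> u\<bar>" using signed_permutation_abs_eq[OF \<sigma>(1), of v u] by auto
    moreover have "v \<noteq> u" using insert.hyps v by auto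
    then have "\<bar>\<alpha> v\<bar> \<noteq> \<bar>\<alpha> u\<bar>" using insert.prems(3)[rule_format, of v u] v by simp
    ultimately show ?thesis using \<tau>(3)[of "\<alpha> v"] \<sigma>(2) v by simp
  qed
  then have "\<forall>v\<in>insert u U. (\<tau> \<circ> \<sigma>) v = \<alpha> v" using \<tau>(2) by simp
  with signed_permutation_comp[OF \<tau>(1) \<sigma>(1)] show ?case by (rule_tac exI, rule_tac conjI)
qed

lemma weighted_monomial_signed_permutation:
  assumes "signed_permutation \<sigma>"
  shows "image_mset \<sigma> (weighted_monomial U c a b \<alpha>) = weighted_monomial U c a b (\<sigma> \<circ> \<alpha>)"
proof -
  have "\<sigma> (- i) = - \<sigma> i" for i using assms by (simp add: signed_permutation_def)
  then show ?thesis unfolding weighted_monomial_def image_mset_union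
    by (subst sum_comp_morphism[symmetric])
      (auto simp: signed_permutation_0[OF assms] comp_def)
qed

text \<open>One representative for each pair i, - i of nonzero indices in \<open>m\<close>. These
  serve as vertices, the exponents at i and - i being the two weights.\<close>

definition positive_support :: "int multiset \<Rightarrow> int set" where
  "positive_support m = {i. 0 < i \<and> (i \<in># m \<or> - i \<in># m)}"

lemma finite_positive_support: "finite (positive_support m)"
  by (rule finite_subset[of _ "set_mset m \<union> uminus ` set_mset m"])
    (auto simp: positive_support_def intro: image_eqI[of _ _ "- _"])

lemma card_positive_support: "card (positive_support m) \<le> size m"
proof -
  obtain xs where xs: "m = mset xs" by (metis ex_mset)
  have "positive_support m \<subseteq> abs ` set xs"
  proof
    fix i assume "i \<in> positive_support m"
    then have "i = \<bar>i\<bar>" "i = \<bar>- i\<bar>" "i \<in> set xs \<or> - i \<in> set xs" by (auto simp: positive_support_def xs)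
    then show "i \<in> abs ` set xs" by (metis imageI)
  qed
  then have "card (positive_support m) \<le> card (abs ` set xs)" by (intro card_mono) auto
  also have "\<dots> \<le> card (set xs)" by (intro card_image_le) auto
  also have "\<dots> \<le> size m" by (simp add: xs card_length)
  finally show ?thesis .
qed

lemma weighted_monomial_positive_support:
  "weighted_monomial (positive_support m) (count m 0) (count m) (\<lambda>i. count m (- i)) (\<lambda>i. i) = m"
proof (rule multiset_eqI)
  fix x
  let ?U = "positive_support m"
  have fin: "finite ?U" by (rule finite_positive_support)
  have "count (weighted_monomial ?U (count m 0) (count m) (\<lambda>i. count m (- i)) (\<lambda>i. i)) x =
      (if x = 0 then count m 0 else 0) + (\<Sum>u\<in>?U. if x = u then count m u else 0) +
        (\<Sum>u\<in>?U. if x = - u then count m (- u) else 0)"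
    by (simp add: weighted_monomial_def count_sum sum.distrib)
  also have "(\<Sum>u\<in>?U. if x = - u then count m (- u) else 0) =
      (\<Sum>u\<in>?U. if - x = u then count m (- u) else 0)"
    by (intro sum.cong) auto
  also have "(if x = 0 then count m 0 else 0) + (\<Sum>u\<in>?U. if x = u then count m u else 0) + \<dots> =
      (if x = 0 then count m 0 else 0) + (if x \<in> ?U then count m x else 0) +
      (if - x \<in> ?U then count m x else 0)"
    using fin by (simp add: sum.delta')
  also have "\<dots> = count m x"
    by (cases x "0 :: int" rule: linorder_cases) (auto simp: positive_support_def not_in_iff)
  finally show "count (weighted_monomial ?U (count m 0) (count m) (\<lambda>i. count m (- i)) (\<lambda>i. i)) x = count m x" .
qed

text \<open>Off these hyperplanes the coordinates are nonzero with distinct absolute values, which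
  is what lets an integer point extend to a signed permutation.\<close>

definition generic_forms :: "'v set \<Rightarrow> (('v \<Rightarrow> real) \<Rightarrow> real) set" where
  "generic_forms U = (\<lambda>(q, i, j) z. z i + q * z j) ` {(q, i, j) \<in> {- 1, 1} \<times> U \<times> U. i \<noteq> j} \<union> (\<lambda>i z. z i) ` U"

lemma finite_generic_forms: "finite U \<Longrightarrow> finite (generic_forms U)"
  unfolding generic_forms_def by (auto intro: finite_subset[of _ "{- 1, 1} \<times> U \<times> U"])

lemma generic_forms_type_B: "generic_forms U \<subseteq> type_B_forms U"
proof
  fix f assume "f \<in> generic_forms U"
  then consider q i j where "f = (\<lambda>z. 1 * z i + q * z j)" "q = - 1 \<or> q = 1" "i \<in> U" "j \<in> U"
    | i where "f = (\<lambda>z. 1 * z i + 0 * z i)" "i \<in> U" by (auto simp: generic_forms_def)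
  then show "f \<in> type_B_forms U"
    unfolding type_B_forms_def by cases blast+
qed

lemma generic_points:
  assumes "\<alpha> \<in> open_points U L" "set L = generic_forms U"
  shows "\<forall>u\<in>U. \<alpha> u \<noteq> 0" "\<forall>u\<in>U. \<forall>v\<in>U. u \<noteq> v \<longrightarrow> \<bar>\<alpha> u\<bar> \<noteq> \<bar>\<alpha> v\<bar>"
proof -
  have nz: "f (of_int \<circ> \<alpha>) \<noteq> 0" if "f \<in> generic_forms U" for f
    using assms that by (simp add: open_points_def)
  show "\<forall>u\<in>U. \<alpha> u \<noteq> 0"
  proof
    fix u assume "u \<in> U"
    then show "\<alpha> u \<noteq> 0" using nz[of "\<lambda>z. z u"] by (simp add: generic_forms_def)
  qed
  show "\<forall>u\<in>U. \<forall>v\<in>U. u \<noteq> v \<longrightarrow> \<bar>\<alpha> u\<bar> \<noteq> \<bar>\<alpha> v\<bar>"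
  proof (intro ballI impI)
    fix u v assume uv: "u \<in> U" "v \<in> U" "u \<noteq> v"
    have "(\<lambda>z. z u + q * z v) \<in> generic_forms U" if "q \<in> {- 1, 1}" for q
      unfolding generic_forms_def using uv that by (intro UnI1 image_eqI[of _ _ "(q, u, v)"]) auto
    from nz[OF this[of 1]] nz[OF this[of "- 1"]] have "\<alpha> u \<noteq> - \<alpha> v" "\<alpha> u \<noteq> \<alpha> v" by auto
    then show "\<bar>\<alpha> u\<bar> \<noteq> \<bar>\<alpha> v\<bar>" by (simp add: abs_eq_iff)
  qed
qed

text \<open>Take the open series of the generic forms with \<open>m\<close> as weight. The identity
  point contributes \<open>m\<close>; any other open point extends to a signed permutation, so it
  contributes a monomial of the same orbit.\<close>

lemma omega_rel_orbit:
  obtains h h' where "omega_rel h h'" "h m \<noteq> 0"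
    "\<And>m'. h m' \<noteq> 0 \<Longrightarrow> \<exists>\<sigma>. signed_permutation \<sigma> \<and> m' = image_mset \<sigma> m"
proof -
  let ?U = "positive_support m" and ?c = "count m 0" and ?a = "count m" and ?b = "\<lambda>i. count m (- i)"
  have fin: "finite ?U" by (rule finite_positive_support)
  then obtain L where L: "set L = generic_forms ?U" using finite_list[OF finite_generic_forms] by blast
  have ab: "\<forall>u\<in>?U. (?a u, ?b u) \<noteq> (0, 0)" by (auto simp: positive_support_def)
  let ?h = "rat_series (open_series ?U ?c ?a ?b L)"
  show thesis
  proof (rule that[of ?h])
    show "omega_rel ?h (scale_series ((- 1) ^ (?c + (\<Sum>u\<in>?U. ?a u + ?b u) + card ?U))
        (rat_series (closed_series ?U ?c ?a ?b L)))"
      using fin ab generic_forms_type_B by (intro omega_rel_open_series) (simp_all add: L)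
  next
    let ?\<alpha> = "restrict (\<lambda>i. i) ?U"
    have "f (of_int \<circ> ?\<alpha>) \<noteq> 0" if "f \<in> generic_forms ?U" for f
      using that by (auto simp: generic_forms_def positive_support_def)
    then have "?\<alpha> \<in> open_points ?U L" by (auto simp: open_points_def L)
    moreover have "weighted_monomial ?U ?c ?a ?b ?\<alpha> = m"
      using weighted_monomial_cong[of ?U ?\<alpha> "\<lambda>i. i"] weighted_monomial_positive_support[of m] by simp
    ultimately have "?\<alpha> \<in> {\<alpha> \<in> open_points ?U L. weighted_monomial ?U ?c ?a ?b \<alpha> = m}" by blast
    moreover have "finite {\<alpha> \<in> open_points ?U L. weighted_monomial ?U ?c ?a ?b \<alpha> = m}"
      by (rule finite_subset[OF _ finite_weighted_monomial_fibre[OF fin ab, of ?c m]]) (auto simp: open_points_def)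
    ultimately have "card {\<alpha> \<in> open_points ?U L. weighted_monomial ?U ?c ?a ?b \<alpha> = m} \<noteq> 0" by auto
    then show "?h m \<noteq> 0" by (simp add: rat_series_def open_series_def monomial_sum_def)
  next
    fix m' assume "?h m' \<noteq> 0"
    then have "card {\<alpha> \<in> open_points ?U L. weighted_monomial ?U ?c ?a ?b \<alpha> = m'} \<noteq> 0"
      by (simp add: rat_series_def open_series_def monomial_sum_def)
    then have "{\<alpha> \<in> open_points ?U L. weighted_monomial ?U ?c ?a ?b \<alpha> = m'} \<noteq> {}" by fastforce
    then obtain \<alpha> where \<alpha>: "\<alpha> \<in> open_points ?U L" "weighted_monomial ?U ?c ?a ?b \<alpha> = m'" by blast
    from signed_permutation_extend[OF fin _ generic_points[OF \<alpha>(1) L]]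
    obtain \<sigma> where \<sigma>: "signed_permutation \<sigma>" "\<forall>u\<in>?U. \<sigma> u = \<alpha> u" by (auto simp: positive_support_def)
    have "image_mset \<sigma> m = weighted_monomial ?U ?c ?a ?b (\<sigma> \<circ> (\<lambda>i. i))"
      using weighted_monomial_signed_permutation[OF \<sigma>(1), of ?U ?c ?a ?b "\<lambda>i. i"]
      by (simp only: weighted_monomial_positive_support)
    also have "\<dots> = m'" unfolding \<alpha>(2)[symmetric] using \<sigma>(2) by (intro weighted_monomial_cong) simp
    finally show "\<exists>\<sigma>. signed_permutation \<sigma> \<and> m' = image_mset \<sigma> m" using \<sigma>(1) by blast
  qed
qed

text \<open>At most \<open>d\<close> pairs of opposite indices occur in \<open>m\<close>, and these
  fit into 1, ..., \<open>d\<close>. Hence every orbit of degree at most \<open>d\<close> meets a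
  fixed finite set of monomials.\<close>

lemma signed_permutation_into_interval:
  assumes "size m \<le> d"
  obtains \<sigma> where "signed_permutation \<sigma>" "set_mset (image_mset \<sigma> m) \<subseteq> {- int d..int d}"
proof -
  let ?U = "positive_support m"
  have "card ?U \<le> card {1..int d}" using card_positive_support[of m] assms by simp
  then obtain \<beta> where \<beta>: "\<beta> ` ?U \<subseteq> {1..int d}" "inj_on \<beta> ?U"
    using card_le_inj[OF finite_positive_support[of m], of "{1..int d}"] by auto
  have "\<forall>u\<in>?U. \<beta> u \<noteq> 0" using \<beta>(1) by fastforce
  moreover have "\<forall>u\<in>?U. \<forall>v\<in>?U. u \<noteq> v \<longrightarrow> \<bar>\<beta> u\<bar> \<noteq> \<bar>\<beta> v\<bar>"
  proof (intro ballI impI)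
    fix u v assume uv: "u \<in> ?U" "v \<in> ?U" "u \<noteq> v"
    then have "\<beta> u \<noteq> \<beta> v" using \<beta>(2) by (auto dest: inj_onD)
    moreover have "0 < \<beta> u" "0 < \<beta> v" using uv \<beta>(1) by (force)+
    ultimately show "\<bar>\<beta> u\<bar> \<noteq> \<bar>\<beta> v\<bar>" by simp
  qed
  ultimately obtain \<sigma> where \<sigma>: "signed_permutation \<sigma>" "\<forall>u\<in>?U. \<sigma> u = \<beta> u"
    using signed_permutation_extend[OF finite_positive_support[of m], of \<beta>] by (auto simp: positive_support_def)
  have "\<sigma> i \<in> {- int d..int d}" if "i \<in># m" for i
  proof (cases "i = 0")
    case False
    then have u: "\<bar>i\<bar> \<in> ?U" using that by (auto simp: positive_support_def abs_if)
    then have "\<sigma> \<bar>i\<bar> \<in> {1..int d}" using \<sigma>(2) \<beta>(1) by auto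
    moreover have "\<sigma> \<bar>i\<bar> = \<sigma> i \<or> \<sigma> \<bar>i\<bar> = - \<sigma> i"
      using \<sigma>(1) by (auto simp: signed_permutation_def abs_if)
    ultimately show ?thesis by auto
  qed (simp add: signed_permutation_0[OF \<sigma>(1)])
  then show thesis using that[OF \<sigma>(1)] by (simp add: image_subset_iff)
qed

text \<open>The support may be infinite, but it is a union of orbits meeting a finite window.
  Subtracting a multiple of an orbit series removes a monomial from the window and adds
  none.\<close>

lemma omega_rel_total:
  assumes "f \<in> carrier SSym_rat"
  shows "\<exists>f'. omega_rel f f'"
proof -
  obtain d where "\<forall>m. f m \<noteq> 0 \<longrightarrow> size m \<le> d"
    and "\<forall>\<sigma> m. signed_permutation \<sigma> \<longrightarrow> f (image_mset \<sigma> m) = f m"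
    using assms unfolding carrier_SSym_rat_iff by blast
  then show ?thesis
  proof (induction "card {m. f m \<noteq> 0 \<and> set_mset m \<subseteq> {- int d..int d}}" arbitrary: f rule: less_induct)
    case less
    let ?S = "\<lambda>f. {m. f m \<noteq> 0 \<and> set_mset m \<subseteq> {- int d..int d}}"
    have fin: "finite (?S f)"
      by (rule finite_subset[OF _ finite_msets_bounded[of "{- int d..int d}" d]]) (use less.prems(1) in auto)
    show ?case
    proof (cases "?S f = {}")
      case True
      have "f m = 0" for m
      proof (rule ccontr)
        assume m: "f m \<noteq> 0"
        then obtain \<sigma> where "signed_permutation \<sigma>" "set_mset (image_mset \<sigma> m) \<subseteq> {- int d..int d}"
          using signed_permutation_into_interval[of m d] less.prems(1) by blast
        then have "image_mset \<sigma> m \<in> ?S f" using m less.prems(2) by simp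
        then show False using True by blast
      qed
      then have "f = (\<lambda>m. 0)" by blast
      then show ?thesis using omega_rel_zero by blast
    next
      case False
      then obtain m\<^sub>0 where m\<^sub>0: "m\<^sub>0 \<in> ?S f" by blast
      obtain h h' where h: "omega_rel h h'" "h m\<^sub>0 \<noteq> 0"
        "\<And>m. h m \<noteq> 0 \<Longrightarrow> \<exists>\<sigma>. signed_permutation \<sigma> \<and> m = image_mset \<sigma> m\<^sub>0"
        using omega_rel_orbit[of m\<^sub>0] by blast
      \<comment> \<open>The factor cancels \<open>m\<^sub>0\<close>. Since \<open>h\<close> lives on
        the orbit of \<open>m\<^sub>0\<close>, where \<open>f\<close> is nonzero by invariance, the
        support does not grow.\<close>
      define g where "g m = f m - f m\<^sub>0 / h m\<^sub>0 * h m" for m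
      have supp: "f m \<noteq> 0" if "g m \<noteq> 0" for m
      proof
        assume "f m = 0"
        then have "h m \<noteq> 0" using that by (auto simp: g_def)
        then show False using h(3) less.prems(2) m\<^sub>0 \<open>f m = 0\<close> by fastforce
      qed
      have "g m\<^sub>0 = 0" using h(2) by (simp add: g_def)
      then have "?S g \<subset> ?S f" using supp m\<^sub>0 by blast
      then have "card (?S g) < card (?S f)" using fin by (rule psubset_card_mono[rotated])
      moreover have "\<forall>m. g m \<noteq> 0 \<longrightarrow> size m \<le> d" using supp less.prems(1) by blast
      moreover have "\<forall>\<sigma> m. signed_permutation \<sigma> \<longrightarrow> g (image_mset \<sigma> m) = g m"
        using less.prems(2) omega_rel_carrier[OF h(1)] unfolding carrier_SSym_rat_iff g_def by metis
      ultimately obtain g' where g': "omega_rel g g'" using less.hyps by blast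
      have "f = (\<lambda>m. g m + scale_series (f m\<^sub>0 / h m\<^sub>0) h m)" by (simp add: g_def scale_series_def)
      then show ?thesis using omega_rel.add[OF g' omega_rel.scale[OF h(1)]] by metis
    qed
  qed
qed

section \<open>Chambers\<close>

lemma type_B_form_restrict:
  assumes "f \<in> type_B_forms V" shows "f (restrict z V) = f z"
  using assms by (auto simp: type_B_forms_def)

lemma continuous_map_type_B_form:
  assumes "f \<in> type_B_forms V" shows "continuous_map (powertop_real V) euclideanreal f"
proof -
  obtain p q u v where f: "f = (\<lambda>z. p * z u + q * z v)" and "p = 0 \<or> u \<in> V" "q = 0 \<or> v \<in> V"
    using assms unfolding type_B_forms_def by blast
  then have "continuous_map (powertop_real V) euclideanreal (\<lambda>z. p * z u)"
    "continuous_map (powertop_real V) euclideanreal (\<lambda>z. q * z v)"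
    by (cases "p = 0"; cases "q = 0";
        auto intro!: continuous_map_real_mult_left continuous_map_product_projection)+
  then show ?thesis unfolding f by (rule continuous_map_add)
qed

definition segment_point :: "'v set \<Rightarrow> ('v \<Rightarrow> real) \<Rightarrow> ('v \<Rightarrow> real) \<Rightarrow> real \<Rightarrow> 'v \<Rightarrow> real" where
  "segment_point V x y t = restrict (\<lambda>v. x v + t * (y v + (- 1) * x v)) V"

lemma type_B_form_segment_point:
  assumes f: "f \<in> type_B_forms V"
  shows "f (segment_point V x y t) = (1 - t) * f x + t * f y"
proof -
  note lin = linear_form_type_B[OF f, unfolded linear_form_def, rule_format]
  have "f (segment_point V x y t) = f (\<lambda>v. x v + t * (y v + (- 1) * x v))"
    unfolding segment_point_def by (rule type_B_form_restrict[OF f])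
  also have "\<dots> = f x + t * f (\<lambda>v. y v + (- 1) * x v)" by (rule lin)
  also have "f (\<lambda>v. y v + (- 1) * x v) = f y + (- 1) * f x" by (rule lin)
  finally show ?thesis by (simp add: algebra_simps)
qed

lemma continuous_map_segment_point:
  "continuous_map euclideanreal (powertop_real V) (segment_point V x y)"
proof -
  have "continuous_map euclideanreal euclideanreal (\<lambda>t. segment_point V x y t v)" if "v \<in> V" for v
    using that by (auto simp: segment_point_def intro!: continuous_intros)
  then show ?thesis
    unfolding continuous_map_componentwise by (auto simp: segment_point_def)
qed

lemma convex_combination_pos:
  fixes p q t :: real
  assumes "0 < t" "t \<le> 1" "0 \<le> p" "0 < q"
  shows "0 < (1 - t) * p + t * q"
  using assms by (intro add_nonneg_pos mult_nonneg_nonneg mult_pos_pos) auto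

text \<open>Serves to count connected components by the sign lists of their points.\<close>

lemma bij_betw_images_same_kernel:
  assumes "\<And>x y. x \<in> A \<Longrightarrow> y \<in> A \<Longrightarrow> g x = g y \<longleftrightarrow> h x = h y"
  shows "\<exists>b. bij_betw b (g ` A) (h ` A)"
proof -
  have inv: "inv_into A g (g x) \<in> A" "g (inv_into A g (g x)) = g x" if "x \<in> A" for x
    using that by (auto intro: inv_into_into f_inv_into_f)
  have h: "h (inv_into A g (g x)) = h x" if "x \<in> A" for x
    using assms[OF inv(1)[OF that] that] inv(2)[OF that] by simp
  have "inj_on (\<lambda>c. h (inv_into A g c)) (g ` A)"
  proof (rule inj_onI, elim imageE)
    fix c d x y assume "h (inv_into A g c) = h (inv_into A g d)" and x: "c = g x" "x \<in> A" and y: "d = g y" "y \<in> A"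
    then have "h x = h y" by (simp add: h)
    then show "c = d" using assms[OF x(2) y(2)] x(1) y(1) by simp
  qed
  moreover have "(\<lambda>c. h (inv_into A g c)) ` g ` A = h ` A" unfolding image_image by (rule image_cong[OF refl h])
  ultimately show ?thesis unfolding bij_betw_def by (intro exI conjI)
qed

section \<open>Components of the complement, their closures and sign lists\<close>

locale type_B_arrangement =
  fixes V :: "'v set" and L :: "(('v \<Rightarrow> real) \<Rightarrow> real) list"
  assumes forms: "set L \<subseteq> type_B_forms V"
begin

definition region :: "('v \<Rightarrow> real) set" where
  "region = {z \<in> V \<rightarrow>\<^sub>E UNIV. \<forall>f\<in>set L. f z \<noteq> 0}"

abbreviation "X \<equiv> subtopology (powertop_real V) region"

lemma topspace_X [simp]: "topspace X = region"
  by (auto simp: region_def)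

definition sign_list :: "('v \<Rightarrow> real) \<Rightarrow> bool list" where
  "sign_list x = map (\<lambda>f. f x > 0) L"

text \<open>A weak inequality at \<open>x\<close> and a strict one at \<open>y\<close> give a strict
  one for every \<open>t > 0\<close>. This serves both to join two points of a chamber and to
  approach a point of its closure.\<close>

lemma segment_point_region:
  assumes x: "x \<in> V \<rightarrow>\<^sub>E UNIV" and y: "y \<in> region" and xy: "\<forall>f\<in>set L. sides f y x (f y > 0)"
    and t: "0 < t" "t \<le> 1"
  shows "segment_point V x y t \<in> region" "sign_list (segment_point V x y t) = sign_list y"
proof -
  have *: "f (segment_point V x y t) \<noteq> 0 \<and> (f (segment_point V x y t) > 0 \<longleftrightarrow> f y > 0)" if f: "f \<in> set L" for f
  proof -
    have "f y \<noteq> 0" using y f by (simp add: region_def)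
    moreover have "sides f y x (f y > 0)" using xy f by blast
    moreover have "f (segment_point V x y t) = (1 - t) * f x + t * f y"
      using f forms by (intro type_B_form_segment_point) auto
    ultimately show ?thesis
      using convex_combination_pos[OF t, of "f x" "f y"] convex_combination_pos[OF t, of "- f x" "- f y"]
      by (auto simp: sides_def split: if_splits)
  qed
  then show "segment_point V x y t \<in> region" by (simp add: region_def segment_point_def)
  show "sign_list (segment_point V x y t) = sign_list y" using * by (simp add: sign_list_def)
qed

lemma sides_self: "y \<in> region \<Longrightarrow> sign_list x = sign_list y \<Longrightarrow> x \<in> region \<Longrightarrow> f \<in> set L \<Longrightarrow> sides f y x (f y > 0)"
  by (auto simp: sides_def sign_list_def region_def not_less order.strict_iff_order)

text \<open>By the intermediate value property no form changes sign on a connected subset of the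
  region; conversely, points with equal signs are joined by a segment inside it.\<close>

lemma connected_component_iff:
  assumes x: "x \<in> region" and y: "y \<in> region"
  shows "connected_component_of X x y \<longleftrightarrow> sign_list x = sign_list y"
proof
  assume "connected_component_of X x y"
  then obtain K where K: "connectedin (powertop_real V) K" "K \<subseteq> region" "x \<in> K" "y \<in> K"
    by (auto simp: connected_component_of_def connectedin_subtopology)
  have "f x > 0 \<longleftrightarrow> f y > 0" if f: "f \<in> set L" for f
  proof (rule ccontr)
    assume ne: "\<not> (f x > 0 \<longleftrightarrow> f y > 0)"
    have "f \<in> type_B_forms V" using f forms by blast
    then have "connectedin euclideanreal (f ` K)"
      using connectedin_continuous_map_image[OF continuous_map_type_B_form K(1)] by blast
    then have conn: "connected (f ` K)" by simp
    have "f x \<noteq> 0" "f y \<noteq> 0" using x y f by (auto simp: region_def)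
    then have "f x \<le> 0 \<and> 0 \<le> f y \<or> f y \<le> 0 \<and> 0 \<le> f x" using ne by linarith
    then have "0 \<in> f ` K"
      using connectedD_interval[OF conn, of "f x" "f y" 0] connectedD_interval[OF conn, of "f y" "f x" 0] K(3,4) by blast
    then obtain z where "z \<in> K" "f z = 0" by auto
    then show False using K(2) f by (auto simp: region_def)
  qed
  then show "sign_list x = sign_list y" by (simp add: sign_list_def)
next
  assume eq: "sign_list x = sign_list y"
  let ?K = "segment_point V x y ` {0..1}"
  have "connectedin euclideanreal {0..1::real}" by simp
  then have "connectedin (powertop_real V) ?K"
    by (rule connectedin_continuous_map_image[OF continuous_map_segment_point])
  moreover have ends: "segment_point V x y 0 = x" "segment_point V x y 1 = y"
    using x y by (auto simp: segment_point_def region_def PiE_iff extensional_restrict)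
  moreover have "?K \<subseteq> region"
  proof
    fix z assume "z \<in> ?K"
    then obtain t where t: "0 \<le> t" "t \<le> 1" "z = segment_point V x y t" by auto
    show "z \<in> region"
    proof (cases "t = 0")
      case False
      then show ?thesis using t segment_point_region(1)[of x y t] x y sides_self[OF y eq x]
        by (simp add: region_def)
    qed (use t ends x in simp)
  qed
  moreover have "x \<in> ?K" "y \<in> ?K"
    using ends by (metis atLeastAtMost_iff imageI order_refl zero_le_one)+
  ultimately show "connected_component_of X x y"
    unfolding connected_component_of_def connectedin_subtopology by blast
qed

abbreviation "component x \<equiv> connected_component_of_set X x"

lemma component_eq:
  assumes x: "x \<in> region" shows "component x = {y \<in> region. sign_list y = sign_list x}"
proof (rule Set.set_eqI)
  fix y
  show "y \<in> component x \<longleftrightarrow> y \<in> {y \<in> region. sign_list y = sign_list x}"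
  proof (cases "y \<in> region")
    case True
    then show ?thesis using connected_component_iff[OF x True] by auto
  next
    case False
    then show ?thesis using connected_component_in_topspace[of X x y] unfolding topspace_X by blast
  qed
qed

text \<open>Weak inequalities define closed sets, which bounds the closure from above. Conversely,
  the segment from \<open>\<alpha>\<close> to \<open>x\<close> lies in the component except perhaps
  at \<open>\<alpha>\<close>, so every neighbourhood of \<open>\<alpha>\<close> meets the
  component.\<close>

lemma closure_component_iff:
  assumes x: "x \<in> region" and \<alpha>: "\<alpha> \<in> V \<rightarrow>\<^sub>E UNIV"
  shows "\<alpha> \<in> powertop_real V closure_of component x \<longleftrightarrow> (\<forall>f\<in>set L. sides f x \<alpha> (f x > 0))"
proof
  assume \<alpha>cl: "\<alpha> \<in> powertop_real V closure_of component x"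
  have closed: "\<alpha> \<in> {z \<in> topspace (powertop_real V). f z \<in> A}"
    if f: "f \<in> set L" and A: "closed A" and sub: "\<And>z. z \<in> component x \<Longrightarrow> f z \<in> A" for f A
  proof -
    have "f \<in> type_B_forms V" using f forms by blast
    then have "closedin (powertop_real V) {z \<in> topspace (powertop_real V). f z \<in> A}"
      using A by (intro closedin_continuous_map_preimage[OF continuous_map_type_B_form]) auto
    moreover have "component x \<subseteq> {z \<in> topspace (powertop_real V). f z \<in> A}"
      using sub component_eq[OF x] by (auto simp: region_def)
    ultimately show ?thesis using closure_of_minimal \<alpha>cl by blast
  qed
  show "\<forall>f\<in>set L. sides f x \<alpha> (f x > 0)"
  proof
    fix f assume f: "f \<in> set L"
    have sgn: "f z > 0 \<longleftrightarrow> f x > 0" "f z \<noteq> 0" if "z \<in> component x" for z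
      using that f unfolding component_eq[OF x] by (auto simp: sign_list_def region_def)
    have "f x \<noteq> 0" using f x by (simp add: region_def)
    then consider "f x > 0" | "f x < 0" by linarith
    then show "sides f x \<alpha> (f x > 0)"
    proof cases
      case 1
      then have "\<alpha> \<in> {z \<in> topspace (powertop_real V). f z \<in> {0..}}"
        using sgn by (intro closed[OF f]) (auto intro: less_imp_le)
      then show ?thesis using 1 by (simp add: sides_def)
    next
      case 2
      then have "\<alpha> \<in> {z \<in> topspace (powertop_real V). f z \<in> {..0}}"
        using sgn by (intro closed[OF f]) (auto simp: not_less)
      then show ?thesis using 2 by (simp add: sides_def)
    qed
  qed
next
  assume sides: "\<forall>f\<in>set L. sides f x \<alpha> (f x > 0)"
  show "\<alpha> \<in> powertop_real V closure_of component x"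
    unfolding in_closure_of
  proof (intro conjI allI impI)
    fix T assume T: "\<alpha> \<in> T \<and> openin (powertop_real V) T"
    have "openin euclideanreal {t \<in> topspace euclideanreal. segment_point V \<alpha> x t \<in> T}"
      using T by (intro openin_continuous_map_preimage[OF continuous_map_segment_point]) auto
    then have "open {t. segment_point V \<alpha> x t \<in> T}" by simp
    moreover have "segment_point V \<alpha> x 0 = \<alpha>"
      using \<alpha> by (simp add: segment_point_def PiE_iff extensional_restrict)
    then have "0 \<in> {t. segment_point V \<alpha> x t \<in> T}" using T by simp
    ultimately obtain \<epsilon> where "\<epsilon> > 0" and "\<forall>t. dist t 0 < \<epsilon> \<longrightarrow> t \<in> {t. segment_point V \<alpha> x t \<in> T}"
      unfolding open_dist by blast
    then have \<epsilon>: "\<epsilon> > 0" "\<And>t. dist t 0 < \<epsilon> \<Longrightarrow> segment_point V \<alpha> x t \<in> T" by simp_all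
    define t where "t = min 1 (\<epsilon> / 2)"
    have t: "0 < t" "t \<le> 1" "dist t 0 < \<epsilon>" using \<epsilon>(1) by (auto simp: t_def)
    have "segment_point V \<alpha> x t \<in> component x"
      using segment_point_region[OF \<alpha> x sides t(1,2)] unfolding component_eq[OF x] by simp
    then show "\<exists>y. y \<in> component x \<and> y \<in> T" using \<epsilon>(2)[OF t(3)] by blast
  qed (use \<alpha> in simp)
qed

lemma component_eq_iff:
  assumes x: "x \<in> region" and y: "y \<in> region"
  shows "component x = component y \<longleftrightarrow> sign_list x = sign_list y"
proof
  assume "component x = component y"
  moreover have "x \<in> component x" using x unfolding component_eq[OF x] by simp
  ultimately show "sign_list x = sign_list y" unfolding component_eq[OF y] by simp
next
  assume "sign_list x = sign_list y"
  then show "component x = component y" unfolding component_eq[OF x] component_eq[OF y] by simp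
qed

lemma finite_components: "finite (component ` region)"
proof -
  have "sign_list ` region \<subseteq> {s. set s \<subseteq> UNIV \<and> length s = length L}" by (auto simp: sign_list_def)
  then have "finite (sign_list ` region)" by (rule finite_subset) (rule finite_lists_length_eq, simp)
  moreover obtain b where "bij_betw b (component ` region) (sign_list ` region)"
    using bij_betw_images_same_kernel[of region component sign_list] component_eq_iff by blast
  ultimately show ?thesis using bij_betw_finite by blast
qed

lemma card_components_closure:
  assumes \<alpha>: "\<alpha> \<in> V \<rightarrow>\<^sub>E UNIV"
  shows "card {C \<in> component ` region. \<alpha> \<in> powertop_real V closure_of C} = card (signs L \<alpha>)"
proof -
  let ?A = "{x \<in> region. \<forall>f\<in>set L. sides f x \<alpha> (f x > 0)}"
  have "{C \<in> component ` region. \<alpha> \<in> powertop_real V closure_of C} = component ` ?A"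
    using closure_component_iff[OF _ \<alpha>] by blast
  moreover have "signs L \<alpha> = sign_list ` ?A"
  proof (intro equalityI subsetI)
    fix s assume "s \<in> signs L \<alpha>"
    then obtain z where z: "list_all2 (\<lambda>f. sides f z \<alpha>) L s" by (auto simp: signs_def)
    \<comment> \<open>A witness in \<open>signs\<close> is an arbitrary function; restriction makes
      it a point of the product space and changes no value of a form.\<close>
    let ?x = "restrict z V"
    have x: "f ?x = f z" if "f \<in> set L" for f using that forms by (intro type_B_form_restrict) auto
    have s: "s ! i = ((L ! i) z > 0) \<and> sides (L ! i) z \<alpha> ((L ! i) z > 0)" if "i < length L" for i
      using list_all2_nthD[OF z that] by (auto simp: sides_def split: if_splits)
    have *: "sides f ?x \<alpha> (f ?x > 0)" if f: "f \<in> set L" for f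
    proof -
      obtain i where "i < length L" "f = L ! i" using f by (auto simp: in_set_conv_nth)
      then have "sides f z \<alpha> (f z > 0)" using s by blast
      then show ?thesis using x[OF f] by (simp add: sides_def)
    qed
    have "s = sign_list ?x"
    proof (rule nth_equalityI)
      show "length s = length (sign_list ?x)" using list_all2_lengthD[OF z] by (simp add: sign_list_def)
      fix i assume "i < length s"
      then have i: "i < length L" using list_all2_lengthD[OF z] by simp
      then show "s ! i = sign_list ?x ! i" using s x[OF nth_mem[OF i]] by (simp add: sign_list_def)
    qed
    moreover have "f ?x \<noteq> 0" if "f \<in> set L" for f
      using *[OF that] by (auto simp: sides_def split: if_splits)
    then have "?x \<in> ?A" using * by (simp add: region_def)
    ultimately show "s \<in> sign_list ` ?A" by (rule image_eqI)
  next
    fix s assume "s \<in> sign_list ` ?A"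
    then obtain x where x: "\<forall>f\<in>set L. sides f x \<alpha> (f x > 0)" and s: "s = sign_list x" by blast
    have "list_all2 (\<lambda>f. sides f x \<alpha>) L s"
      using x by (simp add: s sign_list_def list_all2_conv_all_nth)
    then show "s \<in> signs L \<alpha>" unfolding signs_def by blast
  qed
  moreover obtain b where "bij_betw b (component ` ?A) (sign_list ` ?A)"
    using bij_betw_images_same_kernel[of ?A component sign_list] component_eq_iff by blast
  ultimately show ?thesis by (simp only: bij_betw_same_card)
qed

lemma card_components_containing:
  "card {C \<in> component ` region. z \<in> C} = (if z \<in> region then 1 else 0)"
proof (cases "z \<in> region")
  case True
  have "{C \<in> component ` region. z \<in> C} = {component z}"
    using True component_eq component_eq_iff by auto
  then show ?thesis using True by simp
next
  case False
  then have "{C \<in> component ` region. z \<in> C} = {}" using component_eq by auto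
  then show ?thesis using False by (simp del: Collect_empty_eq)
qed

end

text \<open>Both orders of an edge occur, so a positive edge yields a form and its negative, with
  the same hyperplane.\<close>

definition graph_forms :: "'v signed_graph \<Rightarrow> (('v \<Rightarrow> real) \<Rightarrow> real) set" where
  "graph_forms \<Gamma> = (\<lambda>(i, j) z. z i - z j) ` {(i, j). {i, j} \<in> pos_edges \<Gamma>} \<union>
     (\<lambda>(i, j) z. z i + z j) ` {(i, j). {i, j} \<in> neg_edges \<Gamma>} \<union> (\<lambda>i z. z i) ` loops \<Gamma>"

lemma finite_graph_forms:
  assumes "is_signed_graph \<Gamma>" shows "finite (graph_forms \<Gamma>)"
proof -
  have "{(i, j). {i, j} \<in> pos_edges \<Gamma>} \<subseteq> verts \<Gamma> \<times> verts \<Gamma>" "{(i, j). {i, j} \<in> neg_edges \<Gamma>} \<subseteq> verts \<Gamma> \<times> verts \<Gamma>"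
    "loops \<Gamma> \<subseteq> verts \<Gamma>" "finite (verts \<Gamma>)"
    using assms by (auto simp: is_signed_graph_def)
  then show ?thesis unfolding graph_forms_def
    by (intro finite_UnI finite_imageI) (auto intro: finite_subset[of _ "verts \<Gamma> \<times> verts \<Gamma>"] finite_subset)
qed

lemma graph_forms_type_B:
  assumes "is_signed_graph \<Gamma>" shows "graph_forms \<Gamma> \<subseteq> type_B_forms (verts \<Gamma>)"
proof
  fix f assume "f \<in> graph_forms \<Gamma>"
  then consider i j where "f = (\<lambda>z. 1 * z i + (- 1) * z j)" "{i, j} \<in> pos_edges \<Gamma>"
    | i j where "f = (\<lambda>z. 1 * z i + 1 * z j)" "{i, j} \<in> neg_edges \<Gamma>"
    | i where "f = (\<lambda>z. 1 * z i + 0 * z i)" "i \<in> loops \<Gamma>" by (auto simp: graph_forms_def)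
  then show "f \<in> type_B_forms (verts \<Gamma>)"
  proof cases
    case 1
    then have "i \<in> verts \<Gamma>" "j \<in> verts \<Gamma>" using assms by (auto simp: is_signed_graph_def)
    then show ?thesis using 1 unfolding type_B_forms_def by blast
  next
    case 2
    then have "i \<in> verts \<Gamma>" "j \<in> verts \<Gamma>" using assms by (auto simp: is_signed_graph_def)
    then show ?thesis using 2 unfolding type_B_forms_def by blast
  next
    case 3
    then have "i \<in> verts \<Gamma>" using assms by (auto simp: is_signed_graph_def)
    then show ?thesis using 3 unfolding type_B_forms_def by blast
  qed
qed

lemma complement_arrangement:
  "topspace (powertop_real (verts \<Gamma>)) - \<Union>(arrangement \<Gamma>) =
     {z \<in> verts \<Gamma> \<rightarrow>\<^sub>E UNIV. \<forall>f\<in>graph_forms \<Gamma>. f z \<noteq> 0}"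
proof (rule Set.set_eqI)
  fix z :: "'a \<Rightarrow> real"
  let ?P = "\<lambda>i j. {i, j} \<in> pos_edges \<Gamma>" and ?N = "\<lambda>i j. {i, j} \<in> neg_edges \<Gamma>" and ?L = "\<lambda>i. i \<in> loops \<Gamma>"
  let ?Z = "(\<exists>i j. ?P i j \<and> z i = z j) \<or> (\<exists>i j. ?N i j \<and> z i = - z j) \<or> (\<exists>i. ?L i \<and> z i = 0)"
  have "(\<exists>f\<in>graph_forms \<Gamma>. f z = 0) \<longleftrightarrow> ?Z"
    unfolding graph_forms_def bex_Un bex_simps(7) by (simp add: Bex_def eq_neg_iff_add_eq_0)
  moreover have "(\<exists>H\<in>arrangement \<Gamma>. z \<in> H) \<longleftrightarrow> ?Z" if "z \<in> topspace (powertop_real (verts \<Gamma>))"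
  proof -
    have *: "(\<exists>H\<in>{h i j | i j. Q i j}. z \<in> H) \<longleftrightarrow> (\<exists>i j. Q i j \<and> z \<in> h i j)"
      for h :: "'a \<Rightarrow> 'a \<Rightarrow> ('a \<Rightarrow> real) set" and Q by blast
    have **: "(\<exists>H\<in>{h i | i. Q i}. z \<in> H) \<longleftrightarrow> (\<exists>i. Q i \<and> z \<in> h i)"
      for h :: "'a \<Rightarrow> ('a \<Rightarrow> real) set" and Q by blast
    show ?thesis unfolding arrangement_def bex_Un * ** using that by simp
  qed
  ultimately show "z \<in> topspace (powertop_real (verts \<Gamma>)) - \<Union>(arrangement \<Gamma>) \<longleftrightarrow>
      z \<in> {z \<in> verts \<Gamma> \<rightarrow>\<^sub>E UNIV. \<forall>f\<in>graph_forms \<Gamma>. f z \<noteq> 0}"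
    by auto
qed

section \<open>Double counting of lattice points and chambers\<close>

lemma weighted_monomial_point_monomial:
  assumes "finite V"
  shows "weighted_monomial V 0 (\<lambda>_. 1) (\<lambda>_. 0) = point_monomial V"
  using assms unfolding weighted_monomial_def point_monomial_def fun_eq_iff
  by (induction V rule: finite_induct) auto

lemma finite_point_monomial_fibre:
  assumes "finite V" shows "finite {\<alpha> \<in> V \<rightarrow>\<^sub>E UNIV. point_monomial V \<alpha> = m}"
  using finite_weighted_monomial_fibre[OF assms, of "\<lambda>_. 1" "\<lambda>_. 0" 0 m]
  unfolding weighted_monomial_point_monomial[OF assms] by simp

lemma sum_card_swap:
  assumes "finite A" "finite B"
  shows "(\<Sum>x\<in>A. int (card {y \<in> B. R x y})) = (\<Sum>y\<in>B. int (card {x \<in> A. R x y}))"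
  using sum.swap_restrict[OF assms, of "\<lambda>_ _. 1 :: int" R] by simp

text \<open>Exchanges the sum over chambers with the sum over points. \<open>P\<close> is the
  identity for the open series and the closure operator for the closed one.\<close>

lemma sum_monomial_sum_lattice_points:
  assumes V: "finite V" and \<C>: "finite \<C>"
  shows "(\<Sum>C\<in>\<C>. monomial_sum (lattice_points V (P C)) (point_monomial V) m) =
    (\<Sum>\<alpha>\<in>{\<alpha> \<in> V \<rightarrow>\<^sub>E UNIV. point_monomial V \<alpha> = m}.
      int (card {C \<in> \<C>. restrict (of_int \<circ> \<alpha>) V \<in> P C}))"
proof -
  let ?F = "{\<alpha> \<in> V \<rightarrow>\<^sub>E UNIV. point_monomial V \<alpha> = m}"
  have fin: "finite ?F"
    by (rule finite_point_monomial_fibre[OF V])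
  have "{\<alpha> \<in> lattice_points V (P C). point_monomial V \<alpha> = m} =
      {\<alpha> \<in> ?F. restrict (of_int \<circ> \<alpha>) V \<in> P C}" for C
    by (auto simp: lattice_points_def comp_def)
  then show ?thesis unfolding monomial_sum_def by (simp only: sum_card_swap[OF \<C> fin])
qed

theorem theorem1p7:
  fixes \<Gamma> :: "'v signed_graph"
  assumes "is_signed_graph \<Gamma>"
  shows "omega (rat_series (chromatic \<Gamma>)) = rat_series (chromatic_closed \<Gamma>)"
proof -
  let ?V = "verts \<Gamma>"
  have V: "finite ?V" using assms by (simp add: is_signed_graph_def)
  obtain L where L: "set L = graph_forms \<Gamma>" using finite_list[OF finite_graph_forms[OF assms]] by blast
  interpret type_B_arrangement ?V L
    using graph_forms_type_B[OF assms] by unfold_locales (simp add: L)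
  have chambers: "chambers \<Gamma> = component ` region"
    unfolding chambers_def complement_arrangement connected_components_of_def
    by (simp only: L[symmetric] region_def[symmetric] topspace_X)
  note wm = weighted_monomial_point_monomial[OF V]
  have form: "f (restrict z ?V) = f z" if "f \<in> set L" for f z
    using that forms by (intro type_B_form_restrict) auto
  have "chromatic \<Gamma> m = open_series ?V 0 (\<lambda>_. 1) (\<lambda>_. 0) L m" for m
  proof -
    have region_iff: "restrict (of_int \<circ> \<alpha>) ?V \<in> region \<longleftrightarrow> (\<forall>f\<in>set L. f (of_int \<circ> \<alpha>) \<noteq> 0)" for \<alpha>
    proof -
      have "(\<forall>f\<in>set L. f (restrict (of_int \<circ> \<alpha>) ?V) \<noteq> 0) \<longleftrightarrow> (\<forall>f\<in>set L. f (of_int \<circ> \<alpha>) \<noteq> 0)"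
        by (intro ball_cong refl) (simp only: form)
      then show ?thesis unfolding region_def by simp
    qed
    let ?F = "{\<alpha> \<in> ?V \<rightarrow>\<^sub>E UNIV. point_monomial ?V \<alpha> = m}"
    have "chromatic \<Gamma> m = (\<Sum>\<alpha>\<in>?F. int (card {C \<in> component ` region. restrict (of_int \<circ> \<alpha>) ?V \<in> C}))"
      unfolding chromatic_def chambers by (rule sum_monomial_sum_lattice_points[OF V finite_components])
    also have "\<dots> = (\<Sum>\<alpha>\<in>?F. if \<forall>f\<in>set L. f (of_int \<circ> \<alpha>) \<noteq> 0 then 1 else 0)"
      unfolding card_components_containing region_iff by (intro sum.cong refl) simp
    also have "\<dots> = int (card {\<alpha> \<in> ?F. \<forall>f\<in>set L. f (of_int \<circ> \<alpha>) \<noteq> 0})"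
      unfolding sum.inter_filter[OF finite_point_monomial_fibre[OF V], symmetric] by simp
    also have "{\<alpha> \<in> ?F. \<forall>f\<in>set L. f (of_int \<circ> \<alpha>) \<noteq> 0} =
        {\<alpha> \<in> open_points ?V L. point_monomial ?V \<alpha> = m}"
      unfolding open_points_def by blast
    finally show ?thesis by (simp only: open_series_def monomial_sum_def wm)
  qed
  then have 1: "chromatic \<Gamma> = open_series ?V 0 (\<lambda>_. 1) (\<lambda>_. 0) L" by blast
  have restrict_in: "restrict z ?V \<in> ?V \<rightarrow>\<^sub>E UNIV" for z :: "'v \<Rightarrow> real" by simp
  have "chromatic_closed \<Gamma> m = closed_series ?V 0 (\<lambda>_. 1) (\<lambda>_. 0) L m" for m
  proof -
    have "signs L (restrict (of_int \<circ> \<alpha>) ?V) = signs L (of_int \<circ> \<alpha>)" for \<alpha>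
    proof -
      have "list_all2 (\<lambda>f. sides f z (restrict (of_int \<circ> \<alpha>) ?V)) L s \<longleftrightarrow>
          list_all2 (\<lambda>f. sides f z (of_int \<circ> \<alpha>)) L s" for z s
        by (intro list.rel_cong refl) (simp only: sides_def form)
      then show ?thesis unfolding signs_def by (simp only:)
    qed
    moreover have "chromatic_closed \<Gamma> m = (\<Sum>\<alpha>\<in>{\<alpha> \<in> ?V \<rightarrow>\<^sub>E UNIV. point_monomial ?V \<alpha> = m}.
        int (card {C \<in> component ` region. restrict (of_int \<circ> \<alpha>) ?V \<in> powertop_real ?V closure_of C}))"
      unfolding chromatic_closed_def chambers by (rule sum_monomial_sum_lattice_points[OF V finite_components])
    ultimately show ?thesis
      by (simp only: card_components_closure[OF restrict_in] closed_series_def wm)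
  qed
  then have 2: "chromatic_closed \<Gamma> = closed_series ?V 0 (\<lambda>_. 1) (\<lambda>_. 0) L" by blast
  \<comment> \<open>With weight \<open>(1, 0)\<close> at every vertex the degree equals the number
    of vertices, so the sign exponent is even and the sign disappears.\<close>
  have "omega_rel (rat_series (chromatic \<Gamma>)) (rat_series (chromatic_closed \<Gamma>))"
    using omega_rel_open_series[OF V _ forms, of "\<lambda>_. 1" "\<lambda>_. 0" 0]
    by (simp add: 1 2 scale_series_def flip: power_add)
  then show ?thesis by (rule omega_eqI_of_total[rotated]) (rule omega_rel_total)
qed

end
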